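(* Let $k\ge 3$ be an integer and assume that $\mathrm{N}(k')=4k'-5$ for every integer $k'$ with $3\le k'<k$. Then $\mathrm{N}(k)=4k-5$ holds if and only if every nfs-irreducible clause-irreducible unsatisfiable hitting clause-set $F$ with $\delta(F)=k$ satisfies $n(F)\le 4k-5$.
   Context: Variables are positive integers, literals are nonzero integers, the complement of $x$ is $\overline{x}=-x$, and $\mathrm{var}(x)=|x|$. A clause is a finite set of literals with no pair $x,\overline{x}$. A clause-set is a finite set of clauses; $\top$ is the empty clause-set. $n(F)=|\mathrm{var}(F)|$ (number of variables occurring), $c(F)=|F|$, $\delta(F)=c(F)-n(F)$. $F$ is satisfiable if some clause $C$ meets every clause of $F$, otherwise unsatisfiable. $F$ is hitting if any two distinct clauses $C,D\in F$ have some $x\in C$ with $\overline{x}\in D$. $\mathrm{ldeg}_F(x)$ is the number of clauses of $F$ containing $x$; $v\in\mathrm{var}(F)$ is singular if $\min(\mathrm{ldeg}_F(v),\mathrm{ldeg}_F(\overline v))=1$; $F$ is nonsingular if it has no singular variable. $\mathrm{N}(k)\in\mathbb{N}_0\cup\{+\infty\}$ is the supremum of $n(F)$ over nonsingular unsatisfiable hitting clause-sets $F$ with $\delta(F)=k$. A clause-factor is a clause-set $F'\ne\top$ with $\{C\setminus\bigcap F':C\in F'\}$ unsatisfiable; a clause-factor of $F$ is a subset $F'\subseteq F$ that is a clause-factor; it is trivial if $c(F')=1$ or ($F'$ unsatisfiable and $F'=F$). $F$ is clause-irreducible if all its clause-factors are trivial, else clause-reducible. An nfs-pair is $\{E\cup\{x\},E\cup\{\overline{x},y\}\}$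 with $E$ a clause, $\mathrm{var}(x)\ne\mathrm{var}(y)$, $x,\overline x,y,\overline y\notin E$; its nfs-flip is $\{E\cup\{x,\overline y\},E\cup\{y\}\}$. An nfs-flip on $F$ replaces an nfs-pair $P\subseteq F$, neither of whose flip clauses lies in $F$, by its nfs-flip. A clause-irreducible unsatisfiable hitting clause-set is nfs-irreducible if no finite sequence of nfs-flips transforms it into a clause-reducible clause-set. *)

theory Defs
  imports Main "HOL-Library.Extended_Nat"
begin

text \<open>Literals are nonzero integers, the complement of \<open>x\<close> is \<open>- x\<close> and its variable is \<open>\<bar>x\<bar>\<close>.\<close>

definition clause :: "int set \<Rightarrow> bool" where
  "clause C \<longleftrightarrow> finite C \<and> 0 \<notin> C \<and> (\<forall>x\<in>C. - x \<notin> C)"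

definition clause_set :: "int set set \<Rightarrow> bool" where
  "clause_set F \<longleftrightarrow> finite F \<and> (\<forall>C\<in>F. clause C)"

definition vars :: "int set set \<Rightarrow> int set" where
  "vars F = (\<Union>C\<in>F. abs ` C)"

definition num_vars :: "int set set \<Rightarrow> nat" where
  "num_vars F = card (vars F)"

definition num_clauses :: "int set set \<Rightarrow> nat" where
  "num_clauses F = card F"

definition deficiency :: "int set set \<Rightarrow> int" where
  "deficiency F = int (num_clauses F) - int (num_vars F)"

definition satisfiable :: "int set set \<Rightarrow> bool" where
  "satisfiable F \<longleftrightarrow> (\<exists>C. clause C \<and> (\<forall>D\<in>F. C \<inter> D \<noteq> {}))"

definition unsatisfiable :: "int set set \<Rightarrow> bool" where
  "unsatisfiable F \<longleftrightarrow> \<not> satisfiable F"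

definition hitting :: "int set set \<Rightarrow> bool" where
  "hitting F \<longleftrightarrow> (\<forall>C\<in>F. \<forall>D\<in>F. C \<noteq> D \<longrightarrow> (\<exists>x\<in>C. - x \<in> D))"

definition uhit :: "int set set \<Rightarrow> bool" where
  "uhit F \<longleftrightarrow> clause_set F \<and> unsatisfiable F \<and> hitting F"

definition ldeg :: "int set set \<Rightarrow> int \<Rightarrow> nat" where
  "ldeg F x = card {C \<in> F. x \<in> C}"

definition singular_var :: "int set set \<Rightarrow> int \<Rightarrow> bool" where
  "singular_var F v \<longleftrightarrow> v \<in> vars F \<and> min (ldeg F v) (ldeg F (- v)) = 1"

definition nonsingular :: "int set set \<Rightarrow> bool" where
  "nonsingular F \<longleftrightarrow> \<not> (\<exists>v. singular_var F v)"

definition max_vars :: "int \<Rightarrow> enat" where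
  "max_vars k = (SUP F \<in> {F. uhit F \<and> nonsingular F \<and> deficiency F = k}. enat (num_vars F))"

definition clause_factor :: "int set set \<Rightarrow> bool" where
  "clause_factor F' \<longleftrightarrow>
     clause_set F' \<and> F' \<noteq> {} \<and> unsatisfiable {C - \<Inter>F' | C. C \<in> F'}"

definition clause_factor_of :: "int set set \<Rightarrow> int set set \<Rightarrow> bool" where
  "clause_factor_of F' F \<longleftrightarrow> F' \<subseteq> F \<and> clause_factor F'"

definition trivial_clause_factor :: "int set set \<Rightarrow> int set set \<Rightarrow> bool" where
  "trivial_clause_factor F' F \<longleftrightarrow>
     num_clauses F' = 1 \<or> (unsatisfiable F' \<and> F' = F)"

definition clause_irreducible :: "int set set \<Rightarrow> bool" where
  "clause_irreducible F \<longleftrightarrow> (\<forall>F'. clause_factor_of F' F \<longrightarrow> trivial_clause_factor F' F)"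

definition clause_reducible :: "int set set \<Rightarrow> bool" where
  "clause_reducible F \<longleftrightarrow> \<not> clause_irreducible F"

text \<open>\<open>nfs_pair_flip P P'\<close>: \<open>P\<close> is an nfs-pair and \<open>P'\<close> is its nfs-flip.\<close>

definition nfs_pair_flip :: "int set set \<Rightarrow> int set set \<Rightarrow> bool" where
  "nfs_pair_flip P P' \<longleftrightarrow>
     (\<exists>E x y. clause E \<and> x \<noteq> 0 \<and> y \<noteq> 0 \<and> \<bar>x\<bar> \<noteq> \<bar>y\<bar> \<and>
        x \<notin> E \<and> - x \<notin> E \<and> y \<notin> E \<and> - y \<notin> E \<and>
        P = {E \<union> {x}, E \<union> {- x, y}} \<and>
        P' = {E \<union> {x, - y}, E \<union> {y}})"

definition nfs_flip :: "int set set \<Rightarrow> int set set \<Rightarrow> bool" where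
  "nfs_flip F G \<longleftrightarrow>
     (\<exists>P P'. nfs_pair_flip P P' \<and> P \<subseteq> F \<and> P' \<inter> F = {} \<and> G = (F - P) \<union> P')"

definition nfs_irreducible :: "int set set \<Rightarrow> bool" where
  "nfs_irreducible F \<longleftrightarrow>
     uhit F \<and> clause_irreducible F \<and> \<not> (\<exists>G. nfs_flip\<^sup>*\<^sup>* F G \<and> clause_reducible G)"

end

theory Submission
  imports Defs
begin

text \<open>
  Every total assignment falsifies exactly one clause of an unsatisfiable hitting clause-set, so such
  clause-sets are partitions of the cube into subcubes. Setting a literal of minimal degree to true
  loses no further variable; by induction the deficiency bounds the minimal literal degree, so
  nonsingular clause-sets with variables have deficiency at least two, and \<open>N(2) \<le> 3\<close> follows.

  Let \<open>L(F)\<close> be the set of literals of degree one. Setting such a literal to true keeps the deficiency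
  and shrinks \<open>L\<close>, whence \<open>n(F) \<le> 4 \<delta>(F) - 5 + |L(F)|\<close> once this holds for nonsingular
  clause-sets of the same deficiency. A nontrivial clause-factor splits \<open>F\<close> into a residue \<open>R\<close> and a
  contraction \<open>Q\<close> with \<open>s\<close> common variables, \<open>\<delta>(F) = \<delta>(R) + \<delta>(Q) - 1 + s\<close> and
  \<open>|L(R)| + |L(Q)| \<le> 4 s + 1 + |L(F)|\<close>; hence \<open>n(F) \<le> 4 \<delta>(F) - 5 - s + |L(F)|\<close>. This bounds clause-reducible
  nonsingular clause-sets, and also those that a single nfs-flip makes singular, since then
  \<open>|L| = 1\<close> and \<open>s \<ge> 1\<close>. The lower bound comes from gluing copies of the three-variable
  clause-set of deficiency two along new variables.
\<close>

section \<open>Total assignments\<close>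

text \<open>One literal of every variable is chosen, so a single assignment serves all clause-sets
  whatever their variables; \<open>D \<inter> S = {}\<close> then means that \<open>S\<close>
  falsifies \<open>D\<close>. Membership of 0, its own complement, is left open.\<close>

definition total_assignment :: "int set \<Rightarrow> bool" where
  "total_assignment S \<longleftrightarrow> (\<forall>x. x \<noteq> 0 \<longrightarrow> (x \<in> S \<longleftrightarrow> - x \<notin> S))"

lemma clauseD:
  assumes "clause C"
  shows "finite C" "0 \<notin> C" "x \<in> C \<Longrightarrow> - x \<notin> C" "x \<in> C \<Longrightarrow> x \<noteq> 0"
  using assms unfolding clause_def by auto

lemma clause_subset: "clause C \<Longrightarrow> D \<subseteq> C \<Longrightarrow> clause D"
  unfolding clause_def by (meson finite_subset subset_iff)

lemma ex_total_assignment: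
  assumes "clause C" "clause D" "C \<inter> D = {}"
  shows "\<exists>S. total_assignment S \<and> C \<subseteq> S \<and> D \<inter> S = {}"
proof -
  \<comment> \<open>Literals of \<open>C\<close> become true and those of \<open>D\<close> false;
    every remaining variable gets its positive literal.\<close>
  define S where "S = {x. x \<in> C \<or> - x \<in> D \<or> (x > 0 \<and> - x \<notin> C \<and> x \<notin> D)}"
  have "x \<in> S \<longleftrightarrow> - x \<notin> S" if "x \<noteq> 0" for x
  proof -
    have "x > 0 \<longleftrightarrow> \<not> - x > 0" using that by linarith
    moreover have "\<not> (x \<in> C \<and> - x \<in> C)" "\<not> (x \<in> D \<and> - x \<in> D)"
      using clauseD(3)[OF assms(1)] clauseD(3)[OF assms(2)] by auto
    moreover have "\<not> (x \<in> C \<and> x \<in> D)" "\<not> (- x \<in> C \<and> - x \<in> D)"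
      using assms(3) by auto
    ultimately show ?thesis unfolding S_def by auto
  qed
  moreover have "D \<inter> S = {}"
    unfolding S_def using assms clauseD(3)[OF assms(2)] by auto
  ultimately show ?thesis unfolding total_assignment_def S_def by blast
qed

lemma ex_falsifying: "clause D \<Longrightarrow> \<exists>S. total_assignment S \<and> D \<inter> S = {}"
  using ex_total_assignment[of "{}" D] by (auto simp: clause_def)

lemma ex_falsifying_with:
  assumes "clause D" "e \<notin> D" "e \<noteq> 0"
  shows "\<exists>S. total_assignment S \<and> e \<in> S \<and> D \<inter> S = {}"
  using ex_total_assignment[of "{e}" D] assms by (auto simp: clause_def)

lemma ex_falsifying_with2:
  assumes "clause D" "e \<notin> D" "e \<noteq> 0" "f \<notin> D" "f \<noteq> 0" "f \<noteq> - e"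
  shows "\<exists>S. total_assignment S \<and> e \<in> S \<and> f \<in> S \<and> D \<inter> S = {}"
  using ex_total_assignment[of "{e, f}" D] assms by (auto simp: clause_def)

text \<open>Moving from an assignment where \<open>u\<close> is false to its neighbour in the cube
  is the basic move of the later arguments.\<close>

definition set_true :: "int \<Rightarrow> int set \<Rightarrow> int set" where
  "set_true u S = insert u (S - {- u})"

lemma total_set_true:
  assumes "total_assignment S" "u \<noteq> 0"
  shows "total_assignment (set_true u S)"
  unfolding total_assignment_def
proof (intro allI impI)
  fix x :: int assume "x \<noteq> 0"
  then have "x \<in> S \<longleftrightarrow> - x \<notin> S" using assms(1) unfolding total_assignment_def by blast
  moreover have "- x = u \<longleftrightarrow> x = - u" "- x = - u \<longleftrightarrow> x = u" by auto
  moreover have "u \<noteq> - u" using assms(2) by simp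
  ultimately show "x \<in> set_true u S \<longleftrightarrow> - x \<notin> set_true u S"
    unfolding set_true_def by blast
qed

text \<open>Unsatisfiability says that each assignment falsifies at least one clause, hitting says
  at most one. In this pointwise form the property is easy to verify for restrictions, contractions,
  flips and gluings.\<close>

lemma uhit_iff:
  "uhit F \<longleftrightarrow> clause_set F \<and> (\<forall>S. total_assignment S \<longrightarrow> (\<exists>!D. D \<in> F \<and> D \<inter> S = {}))"
proof
  assume F: "uhit F"
  then have cs: "clause_set F" and us: "unsatisfiable F" and hit: "hitting F"
    unfolding uhit_def by auto
  have "\<exists>!D. D \<in> F \<and> D \<inter> S = {}" if S: "total_assignment S" for S
  proof -
    have "\<exists>D\<in>F. D \<inter> S = {}"
    proof (rule ccontr)
      assume a: "\<not> (\<exists>D\<in>F. D \<inter> S = {})"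
      have nz: "0 \<notin> \<Union>F" and fin: "finite (\<Union>F)"
        using cs clauseD(1,2) unfolding clause_set_def by blast+
      have "- x \<notin> S" if "x \<in> S \<inter> \<Union>F" for x
      proof -
        have "x \<noteq> 0" using that nz by (metis IntD2)
        then show ?thesis using that S unfolding total_assignment_def by blast
      qed
      \<comment> \<open>Satisfiability asks for a finite clause, so \<open>S\<close> is cut down to
        the literals of \<open>F\<close>.\<close>
      then have "clause (S \<inter> \<Union>F)" using nz fin unfolding clause_def by blast
      moreover have "\<forall>D\<in>F. (S \<inter> \<Union>F) \<inter> D \<noteq> {}" using a by blast
      ultimately show False using us unfolding unsatisfiable_def satisfiable_def by blast
    qed
    moreover have "C = D" if CD: "C \<in> F" "D \<in> F" "C \<inter> S = {}" "D \<inter> S = {}" for C D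
    proof (rule ccontr)
      assume "C \<noteq> D"
      then obtain x where "x \<in> C" "- x \<in> D" using hit CD unfolding hitting_def by blast
      moreover have "x \<noteq> 0" using \<open>x \<in> C\<close> \<open>C \<in> F\<close> cs clauseD(4) unfolding clause_set_def by blast
      ultimately show False using S that unfolding total_assignment_def by blast
    qed
    ultimately show ?thesis by blast
  qed
  then show "clause_set F \<and> (\<forall>S. total_assignment S \<longrightarrow> (\<exists>!D. D \<in> F \<and> D \<inter> S = {}))" using cs by blast
next
  assume a: "clause_set F \<and> (\<forall>S. total_assignment S \<longrightarrow> (\<exists>!D. D \<in> F \<and> D \<inter> S = {}))"
  then have "clause_set F"
    and ex: "\<And>S. total_assignment S \<Longrightarrow> \<exists>D. D \<in> F \<and> D \<inter> S = {}"
    and uniq: "\<And>S C D. total_assignment S \<Longrightarrow> C \<in> F \<and> C \<inter> S = {} \<Longrightarrow> D \<in> F \<and> D \<inter> S = {} \<Longrightarrow> C = D"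
    by (simp, metis, metis)
  then have cl: "clause C" if "C \<in> F" for C using that by (simp add: clause_set_def)
  have "unsatisfiable F"
    unfolding unsatisfiable_def satisfiable_def
  proof
    assume "\<exists>C. clause C \<and> (\<forall>D\<in>F. C \<inter> D \<noteq> {})"
    then obtain C where C: "clause C" "\<forall>D\<in>F. C \<inter> D \<noteq> {}" by blast
    obtain S where "total_assignment S" "C \<subseteq> S" using ex_total_assignment[OF C(1), of "{}"] by (auto simp: clause_def)
    then show False using ex[of S] C by blast
  qed
  moreover have "hitting F" unfolding hitting_def
  proof (intro ballI impI, rule ccontr)
    fix C D assume CD: "C \<in> F" "D \<in> F" "C \<noteq> D" "\<not> (\<exists>x\<in>C. - x \<in> D)"
    have "- x \<notin> C" if "x \<in> D" for x using that CD(4) by (metis minus_minus)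
    \<comment> \<open>Without a clash the union is again a clause, and an assignment falsifying it
      falsifies both \<open>C\<close> and \<open>D\<close>.\<close>
    then have "clause (C \<union> D)" using cl[OF CD(1)] cl[OF CD(2)] CD(4)
      unfolding clause_def by blast
    then obtain S where "total_assignment S" "(C \<union> D) \<inter> S = {}" using ex_falsifying by blast
    then show False using uniq[of S C D] CD by blast
  qed
  ultimately show "uhit F" using a unfolding uhit_def by blast
qed

lemma uhit_clause_set: "uhit F \<Longrightarrow> clause_set F"
  by (simp add: uhit_def)

lemma uhit_finite: "uhit F \<Longrightarrow> finite F"
  by (simp add: uhit_def clause_set_def)

lemma uhit_clause: "uhit F \<Longrightarrow> C \<in> F \<Longrightarrow> clause C"
  by (simp add: uhit_def clause_set_def)

lemma uhit_ex: "uhit F \<Longrightarrow> total_assignment S \<Longrightarrow> \<exists>D\<in>F. D \<inter> S = {}"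
  unfolding uhit_iff by blast

lemma uhit_unique:
  "uhit F \<Longrightarrow> total_assignment S \<Longrightarrow> C \<in> F \<Longrightarrow> D \<in> F \<Longrightarrow> C \<inter> S = {} \<Longrightarrow> D \<inter> S = {} \<Longrightarrow> C = D"
  unfolding uhit_iff by blast

lemma uhit_clash:
  "uhit F \<Longrightarrow> C \<in> F \<Longrightarrow> D \<in> F \<Longrightarrow> C \<noteq> D \<Longrightarrow> \<exists>x\<in>C. - x \<in> D"
  unfolding uhit_def hitting_def by blast

lemma uhit_lit_nonzero: "uhit F \<Longrightarrow> x \<in> \<Union>F \<Longrightarrow> x \<noteq> 0"
  using uhit_clause clauseD(4) by blast

text \<open>Some clause \<open>K\<close> is falsified once \<open>u\<close> is true. If it lacked
  \<open>- u\<close>, it would already be falsified by \<open>S\<close> and hence be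
  \<open>D\<close>, which contains the now true \<open>u\<close>.\<close>

lemma uhit_flip:
  assumes "uhit F" "D \<in> F" "u \<in> D" "total_assignment S" "D \<inter> S = {}"
  shows "\<exists>K\<in>F. - u \<in> K \<and> K \<inter> set_true u S = {}"
proof -
  have u: "u \<noteq> 0" using assms uhit_lit_nonzero by blast
  obtain K where K: "K \<in> F" "K \<inter> set_true u S = {}"
    using uhit_ex[OF assms(1) total_set_true[OF assms(4) u]] by blast
  have "- u \<in> K"
  proof (rule ccontr)
    assume "- u \<notin> K"
    then have "K \<inter> S = {}" using K(2) unfolding set_true_def by blast
    then have "K = D" using uhit_unique assms K(1) by blast
    then show False using K(2) assms(3) unfolding set_true_def by blast
  qed
  then show ?thesis using K by blast
qed

lemma uhit_complement_occurs:
  assumes "uhit F" "u \<in> \<Union>F"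
  shows "- u \<in> \<Union>F"
proof -
  obtain D where D: "D \<in> F" "u \<in> D" using assms(2) by blast
  obtain S where "total_assignment S" "D \<inter> S = {}" using ex_falsifying uhit_clause assms(1) D(1) by blast
  then show ?thesis using uhit_flip[OF assms(1) D] by blast
qed

section \<open>Literal degrees and singular literals\<close>

lemma vars_eq: "vars F = abs ` \<Union>F"
  unfolding vars_def by blast

lemma finite_lits: "clause_set F \<Longrightarrow> finite (\<Union>F)"
  unfolding clause_set_def using clauseD(1) by blast

lemma finite_vars: "clause_set F \<Longrightarrow> finite (vars F)"
  by (simp add: vars_eq finite_lits)

lemma uhit_abs_in_vars:
  assumes "uhit F"
  shows "\<bar>x\<bar> \<in> vars F \<longleftrightarrow> x \<in> \<Union>F"
proof
  assume "\<bar>x\<bar> \<in> vars F"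
  then obtain y where y: "y \<in> \<Union>F" "\<bar>x\<bar> = \<bar>y\<bar>" unfolding vars_eq by blast
  then have "x = y \<or> x = - y" by (simp add: abs_eq_iff)
  then show "x \<in> \<Union>F" using y uhit_complement_occurs[OF assms] by blast
qed (auto simp: vars_eq)

lemma ldeg_pos:
  assumes "uhit F"
  shows "0 < ldeg F x \<longleftrightarrow> x \<in> \<Union>F"
  using uhit_finite[OF assms] unfolding ldeg_def by (auto simp: card_gt_0_iff)

text \<open>Literals rather than variables are collected: a variable with degree one in both signs
  counts twice, as the bounds below require.\<close>

definition sing_lits :: "int set set \<Rightarrow> int set" where
  "sing_lits F = {l. ldeg F l = 1}"

lemma sing_lits_subset:
  assumes "uhit F"
  shows "sing_lits F \<subseteq> \<Union>F"
proof
  fix l assume "l \<in> sing_lits F"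
  then show "l \<in> \<Union>F" using ldeg_pos[OF assms, of l] unfolding sing_lits_def by simp
qed

lemma finite_sing_lits: "uhit F \<Longrightarrow> finite (sing_lits F)"
  by (rule finite_subset[OF sing_lits_subset finite_lits[OF uhit_clause_set]])

lemma nonsingular_iff:
  assumes "uhit F"
  shows "nonsingular F \<longleftrightarrow> sing_lits F = {}"
proof
  assume ns: "nonsingular F"
  show "sing_lits F = {}"
  proof (rule ccontr)
    assume "sing_lits F \<noteq> {}"
    then obtain l where l: "ldeg F l = 1" unfolding sing_lits_def by auto
    then have lF: "l \<in> \<Union>F" using ldeg_pos[OF assms, of l] by simp
    then have "- l \<in> \<Union>F" using uhit_complement_occurs[OF assms] by simp
    then have "1 \<le> ldeg F (- l)" using ldeg_pos[OF assms, of "- l"] by simp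
    then have "min (ldeg F \<bar>l\<bar>) (ldeg F (- \<bar>l\<bar>)) = 1" using l by (auto simp: abs_if)
    moreover have "\<bar>l\<bar> \<in> vars F" using lF by (auto simp: vars_eq)
    ultimately show False using ns unfolding nonsingular_def singular_var_def by blast
  qed
next
  assume "sing_lits F = {}"
  then have "ldeg F l \<noteq> 1" for l unfolding sing_lits_def by auto
  then show "nonsingular F" unfolding nonsingular_def singular_var_def min_def by metis
qed

lemma ldeg_one_unique:
  assumes "ldeg F l = 1" "l \<in> C" "C \<in> F" "l \<in> D" "D \<in> F"
  shows "C = D"
proof -
  obtain K where K: "{C \<in> F. l \<in> C} = {K}"
    using assms(1) unfolding ldeg_def by (rule card_1_singletonE)
  have "C \<in> {K}" "D \<in> {K}" unfolding K[symmetric] using assms(2-5) by simp_all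
  then show ?thesis by simp
qed

text \<open>Flipping \<open>v\<close> in an assignment that falsifies \<open>D\<close> must lead
  into \<open>C\<close>, the only clause with \<open>v\<close>. A literal of \<open>C - {v}\<close>
  missing from \<open>D\<close> could be made true beforehand and would block this.\<close>

lemma singular_clause_subset:
  assumes F: "uhit F" and deg: "ldeg F v = 1" and C: "C \<in> F" "v \<in> C" and D: "D \<in> F" "- v \<in> D"
  shows "C - {v} \<subseteq> D"
proof
  fix e assume e: "e \<in> C - {v}"
  show "e \<in> D"
  proof (rule ccontr)
    assume "e \<notin> D"
    moreover have e0: "e \<noteq> 0" using e C F uhit_lit_nonzero by blast
    ultimately obtain S where S: "total_assignment S" "e \<in> S" "D \<inter> S = {}"
      using ex_falsifying_with uhit_clause[OF F D(1)] by blast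
    obtain K where K: "K \<in> F" "v \<in> K" "K \<inter> set_true (- v) S = {}"
      using uhit_flip[OF F D S(1,3)] by auto
    have "K = C" using ldeg_one_unique deg K C by blast
    then show False using K e S unfolding set_true_def by auto
  qed
qed

text \<open>A clause with \<open>- l\<close> contains all of \<open>K\<close> except
  \<open>l\<close>, hence \<open>m\<close>; as \<open>m\<close> has degree one, that clause would be
  \<open>K\<close> itself.\<close>

lemma singular_lits_in_clause:
  assumes F: "uhit F" and K: "K \<in> F" "l \<in> K" "m \<in> K" and deg: "ldeg F l = 1" "ldeg F m = 1"
  shows "l = m"
proof (rule ccontr)
  assume "l \<noteq> m"
  obtain M where M: "M \<in> F" "- l \<in> M" using uhit_complement_occurs[OF F] K by blast
  have "m \<in> M" using singular_clause_subset[OF F deg(1) K(1,2) M] K \<open>l \<noteq> m\<close> by blast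
  then have "M = K" using ldeg_one_unique deg K M by blast
  then show False using M K clauseD(3)[OF uhit_clause[OF F K(1)]] by blast
qed

section \<open>Setting a literal to true\<close>

definition restr :: "int \<Rightarrow> int set set \<Rightarrow> int set set" where
  "restr v F = (\<lambda>K. K - {- v}) ` {K \<in> F. v \<notin> K}"

lemma uhit_restr:
  assumes F: "uhit F" and v: "v \<noteq> 0"
  shows "uhit (restr v F)"
  unfolding uhit_iff
proof (intro conjI allI impI)
  show "clause_set (restr v F)"
    using uhit_clause_set[OF F] unfolding clause_set_def restr_def
    by (auto intro: clause_subset)
  fix S assume S: "total_assignment S"
  let ?S = "set_true v S"
  have S': "total_assignment ?S" using total_set_true[OF S v] .
  have iff: "(K - {- v}) \<inter> S = {} \<longleftrightarrow> K \<inter> ?S = {}" if "v \<notin> K" for K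
    using that v unfolding set_true_def by blast
  obtain K where K: "K \<in> F" "K \<inter> ?S = {}" using uhit_ex[OF F S'] by blast
  then have "v \<notin> K" by (auto simp: set_true_def)
  show "\<exists>!D. D \<in> restr v F \<and> D \<inter> S = {}"
  proof (rule ex1I)
    show "K - {- v} \<in> restr v F \<and> (K - {- v}) \<inter> S = {}"
      using K \<open>v \<notin> K\<close> iff unfolding restr_def by blast
    fix D assume "D \<in> restr v F \<and> D \<inter> S = {}"
    then obtain M where M: "M \<in> F" "v \<notin> M" "D = M - {- v}" "M \<inter> ?S = {}"
      using iff unfolding restr_def by blast
    then show "D = K - {- v}" using uhit_unique[OF F S' M(1) K(1)] K by blast
  qed
qed

text \<open>Two clauses without \<open>v\<close> clash in a variable other than that of
  \<open>v\<close>, so the clash survives the removal of \<open>- v\<close>. Hence restriction loses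
  exactly the clauses that contain \<open>v\<close>.\<close>

lemma inj_on_restr:
  assumes "uhit F"
  shows "inj_on (\<lambda>K. K - {- v}) {K \<in> F. v \<notin> K}"
proof (rule inj_onI, rule ccontr)
  fix C D assume a: "C \<in> {K \<in> F. v \<notin> K}" "D \<in> {K \<in> F. v \<notin> K}" "C - {- v} = D - {- v}" "C \<noteq> D"
  then obtain x where x: "x \<in> C" "- x \<in> D" using uhit_clash[OF assms] by blast
  have "x \<noteq> v" using a(1) x(1) by blast
  then have "- x \<in> D - {- v}" using x(2) by simp
  then have "- x \<in> C" using a(3) by blast
  then show False using x a clauseD(3)[OF uhit_clause[OF assms]] by blast
qed

lemma card_restr:
  assumes "uhit F"
  shows "card (restr v F) + ldeg F v = card F"
proof -
  have "card (restr v F) = card {K \<in> F. v \<notin> K}"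
    unfolding restr_def by (rule card_image[OF inj_on_restr[OF assms]])
  moreover have "card F = card {K \<in> F. v \<notin> K} + card {K \<in> F. v \<in> K}"
    using uhit_finite[OF assms] by (subst card_Un_disjoint[symmetric]) (auto intro: arg_cong[where f = card])
  ultimately show ?thesis unfolding ldeg_def by simp
qed

lemma ldeg_restr:
  assumes "uhit F" "l \<noteq> - v"
  shows "ldeg (restr v F) l = card {K \<in> F. v \<notin> K \<and> l \<in> K}"
proof -
  have "{C \<in> restr v F. l \<in> C} = (\<lambda>K. K - {- v}) ` {K \<in> F. v \<notin> K \<and> l \<in> K}"
    using assms(2) unfolding restr_def by blast
  moreover have "inj_on (\<lambda>K. K - {- v}) {K \<in> F. v \<notin> K \<and> l \<in> K}"
    using inj_on_restr[OF assms(1)] by (rule inj_on_subset) blast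
  ultimately show ?thesis unfolding ldeg_def by (simp add: card_image)
qed

lemma lits_restr: "v \<notin> \<Union>(restr v F)" "- v \<notin> \<Union>(restr v F)" "\<Union>(restr v F) \<subseteq> \<Union>F"
  unfolding restr_def by auto

text \<open>A variable \<open>w\<close> lost by setting \<open>v\<close> to true occurs only in clauses containing \<open>v\<close>, and it
  occurs there in both signs, so \<open>w\<close> would have smaller degree than \<open>v\<close>.\<close>

lemma vars_restr:
  assumes F: "uhit F" and min: "\<And>l. l \<in> \<Union>F \<Longrightarrow> ldeg F v \<le> ldeg F l"
  shows "vars (restr v F) = vars F - {\<bar>v\<bar>}"
proof
  show "vars (restr v F) \<subseteq> vars F - {\<bar>v\<bar>}"
  proof
    fix y assume "y \<in> vars (restr v F)"
    then obtain w where w: "w \<in> \<Union>(restr v F)" "y = \<bar>w\<bar>" unfolding vars_eq by blast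
    then have "w \<noteq> v" "w \<noteq> - v" "w \<in> \<Union>F" using lits_restr[of v F] by blast+
    then have "y \<in> vars F" "y \<noteq> \<bar>v\<bar>" using w(2) unfolding vars_eq by (blast, simp add: abs_eq_iff)
    then show "y \<in> vars F - {\<bar>v\<bar>}" by blast
  qed
  show "vars F - {\<bar>v\<bar>} \<subseteq> vars (restr v F)"
  proof
    fix x assume x: "x \<in> vars F - {\<bar>v\<bar>}"
    then obtain w where w: "w \<in> \<Union>F" "x = \<bar>w\<bar>" unfolding vars_eq by blast
    then have nw: "- w \<in> \<Union>F" using uhit_complement_occurs[OF F] by blast
    have ne: "w \<noteq> - v" "- w \<noteq> - v" using x w by auto
    show "x \<in> vars (restr v F)"
    proof (rule ccontr)
      assume "x \<notin> vars (restr v F)"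
      then have lost: "w \<notin> \<Union>(restr v F)" "- w \<notin> \<Union>(restr v F)"
        using w(2) unfolding vars_eq by (metis image_eqI, metis abs_minus_cancel image_eqI)
      have "w \<notin> K \<and> - w \<notin> K" if "K \<in> F" "v \<notin> K" for K
        using lost ne that unfolding restr_def by blast
      then have "{K \<in> F. w \<in> K} \<union> {K \<in> F. - w \<in> K} \<subseteq> {K \<in> F. v \<in> K}" by blast
      then have "card ({K \<in> F. w \<in> K} \<union> {K \<in> F. - w \<in> K}) \<le> ldeg F v"
        unfolding ldeg_def using uhit_finite[OF F] by (auto intro: card_mono)
      moreover have "card ({K \<in> F. w \<in> K} \<union> {K \<in> F. - w \<in> K}) = ldeg F w + ldeg F (- w)"
        unfolding ldeg_def using uhit_finite[OF F] clauseD(3)[OF uhit_clause[OF F]]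
        by (intro card_Un_disjoint) auto
      moreover have "0 < ldeg F (- w)" using ldeg_pos[OF F, of "- w"] nw by simp
      ultimately show False using min[OF w(1)] by simp
    qed
  qed
qed

lemma deficiency_restr:
  assumes F: "uhit F" and v: "v \<in> \<Union>F" and min: "\<And>l. l \<in> \<Union>F \<Longrightarrow> ldeg F v \<le> ldeg F l"
  shows "num_vars F = Suc (num_vars (restr v F))"
    "deficiency (restr v F) = deficiency F - int (ldeg F v) + 1"
proof -
  have "\<bar>v\<bar> \<in> vars F" using v unfolding vars_eq by blast
  then show nv: "num_vars F = Suc (num_vars (restr v F))"
    using finite_vars[OF uhit_clause_set[OF F]] card_Suc_Diff1[of "vars F" "\<bar>v\<bar>"] vars_restr[OF F min]
    unfolding num_vars_def by metis
  show "deficiency (restr v F) = deficiency F - int (ldeg F v) + 1"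
    using card_restr[OF F, of v] nv unfolding deficiency_def num_clauses_def by linarith
qed

section \<open>Lower bounds for the deficiency, and literals of degree one under restriction\<close>

lemma ex_min_literal:
  assumes "uhit F" "vars F \<noteq> {}"
  obtains v where "v \<in> \<Union>F" "\<And>l. l \<in> \<Union>F \<Longrightarrow> ldeg F v \<le> ldeg F l"
proof -
  obtain v0 where "v0 \<in> \<Union>F" using assms(2) unfolding vars_eq by blast
  then show ?thesis
    using ex_has_least_nat[of "\<lambda>x. x \<in> \<Union>F" v0 "ldeg F"] that by blast
qed

lemma uhit_nonempty: "uhit F \<Longrightarrow> F \<noteq> {}"
  using uhit_ex[of F] ex_falsifying[of "{}"] by (auto simp: clause_def)

text \<open>Setting a literal of minimal degree to true removes exactly one variable and at least
  one clause, so the deficiency does not grow on the way to the variable-free case.\<close>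

lemma deficiency_pos: "uhit F \<Longrightarrow> 1 \<le> deficiency F"
proof (induction "num_vars F" arbitrary: F)
  case 0
  then have "0 < card F" using uhit_nonempty uhit_finite by (simp add: card_gt_0_iff)
  then show ?case using 0 unfolding deficiency_def num_clauses_def by simp
next
  case (Suc n)
  then have "vars F \<noteq> {}" unfolding num_vars_def by auto
  then obtain v where v: "v \<in> \<Union>F" "\<And>l. l \<in> \<Union>F \<Longrightarrow> ldeg F v \<le> ldeg F l"
    using ex_min_literal[OF Suc.prems] by blast
  have "1 \<le> deficiency (restr v F)"
    using Suc.hyps deficiency_restr(1)[OF Suc.prems v] uhit_restr[OF Suc.prems]
      uhit_lit_nonzero[OF Suc.prems v(1)] by simp
  moreover have "0 < ldeg F v" using ldeg_pos[OF Suc.prems] v by blast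
  ultimately show ?case using deficiency_restr(2)[OF Suc.prems v] by linarith
qed

lemma min_degree_le_deficiency:
  assumes "uhit F" "v \<in> \<Union>F" "\<And>l. l \<in> \<Union>F \<Longrightarrow> ldeg F v \<le> ldeg F l"
  shows "int (ldeg F v) \<le> deficiency F"
  using deficiency_restr(2)[OF assms] deficiency_pos[OF uhit_restr[OF assms(1)]]
    uhit_lit_nonzero[OF assms(1,2)] by fastforce

text \<open>Only the clause \<open>C\<close> disappears, so new members of \<open>sing_lits\<close>
  come from \<open>C\<close>. At most one arises, and if one does, then \<open>- v\<close> had
  degree one as well, so that two old members are lost.\<close>

lemma card_sing_lits_restr:
  assumes F: "uhit F" and v: "ldeg F v = 1"
  shows "card (sing_lits (restr v F)) < card (sing_lits F)"
proof -
  have vF: "v \<in> \<Union>F" using ldeg_pos[OF F, of v] v by simp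
  then have v0: "v \<noteq> 0" using uhit_lit_nonzero[OF F] by blast
  let ?T = "restr v F"
  have T: "uhit ?T" using uhit_restr[OF F v0] .
  obtain C where C: "C \<in> F" "v \<in> C" using vF by blast
  have only: "K = C" if "K \<in> F" "v \<in> K" for K using ldeg_one_unique[OF v] C that by blast
  have fin: "finite (sing_lits F)" using finite_sing_lits[OF F] .
  have vS: "v \<in> sing_lits F" using v unfolding sing_lits_def by simp
  have ne: "l \<noteq> v \<and> l \<noteq> - v" if "l \<in> sing_lits ?T" for l
    using sing_lits_subset[OF T] lits_restr[of v F] that by blast
  have old: "l \<in> sing_lits F" if "l \<in> sing_lits ?T" "l \<notin> C" for l
  proof -
    have "{K \<in> F. v \<notin> K \<and> l \<in> K} = {K \<in> F. l \<in> K}" using only that(2) by blast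
    then show ?thesis using that(1) ldeg_restr[OF F, of l v] ne[OF that(1)]
      unfolding sing_lits_def ldeg_def by simp
  qed
  show ?thesis
  proof (cases "sing_lits ?T \<inter> C = {}")
    case True
    then have "sing_lits ?T \<subseteq> sing_lits F - {v}" using old ne by blast
    then show ?thesis using fin vS by (meson card_Diff1_less card_mono finite_Diff le_less_trans)
  next
    case False
    then obtain l0 where l0: "l0 \<in> sing_lits ?T" "l0 \<in> C" by blast
    obtain M where M: "M \<in> F" "- v \<in> M" using uhit_complement_occurs[OF F vF] by blast
    have CM: "C - {v} \<subseteq> K" if "K \<in> F" "- v \<in> K" for K
      using singular_clause_subset[OF F v C that] .
    have vK: "v \<notin> K" if "K \<in> F" "- v \<in> K" for K
      using clauseD(3)[OF uhit_clause[OF F that(1)]] that by blast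
    have MT: "M - {- v} \<in> ?T" using M vK unfolding restr_def by blast
    \<comment> \<open>All of \<open>C\<close> except \<open>v\<close> lies in \<open>M\<close>,
      hence in one clause of the restriction, which has room for only one literal of degree
      one.\<close>
    have uniq: "l = l0" if "l \<in> sing_lits ?T" "l \<in> C" for l
      using singular_lits_in_clause[OF T MT, of l l0] that l0 CM[OF M] ne
      unfolding sing_lits_def by blast
    have "card {K \<in> F. v \<notin> K \<and> l0 \<in> K} = 1"
      using l0 ne ldeg_restr[OF F, of l0 v] unfolding sing_lits_def by auto
    then obtain N where N: "{K \<in> F. v \<notin> K \<and> l0 \<in> K} = {N}" by (rule card_1_singletonE)
    \<comment> \<open>Each clause with \<open>- v\<close> contains \<open>l0\<close>, whose degree
      after restriction is one; so there is just one such clause.\<close>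
    have "K = N" if "K \<in> F" "- v \<in> K" for K
    proof -
      have "l0 \<in> K" using CM[OF that] l0 ne by blast
      then show ?thesis using N vK[OF that] that by blast
    qed
    then have "{K \<in> F. - v \<in> K} = {M}" using M by blast
    then have nvS: "- v \<in> sing_lits F" unfolding sing_lits_def ldeg_def by simp
    have "sing_lits ?T \<subseteq> insert l0 (sing_lits F - {v} - {- v})" using old ne uniq by blast
    then have "card (sing_lits ?T) \<le> Suc (card (sing_lits F - {v} - {- v}))"
      using fin card_mono[OF _ \<open>sing_lits ?T \<subseteq> _\<close>] card_insert_le_m1 by (auto simp: card_insert_if split: if_splits)
    also have "\<dots> = card (sing_lits F - {v})"
      using fin nvS v0 by (intro card_Suc_Diff1) auto
    also have "\<dots> < card (sing_lits F)" using fin vS by (rule card_Diff1_less)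
    finally show ?thesis .
  qed
qed

text \<open>Setting a literal of degree one to true costs one variable and at least one member of
  \<open>sing_lits\<close> at constant deficiency, until a nonsingular clause-set is reached. The
  clause-set consisting of the empty clause would violate the bound, so variables are
  demanded.\<close>

lemma num_vars_le_sing_lits:
  assumes base: "\<And>H. uhit H \<Longrightarrow> sing_lits H = {} \<Longrightarrow> vars H \<noteq> {} \<Longrightarrow> deficiency H = d \<Longrightarrow>
      int (num_vars H) \<le> 4 * d - 5"
    and "uhit F" "vars F \<noteq> {}" "deficiency F = d"
  shows "int (num_vars F) \<le> 4 * d - 5 + int (card (sing_lits F))"
  using assms(2-)
proof (induction "num_vars F" arbitrary: F)
  case 0
  then show ?case using finite_vars[OF uhit_clause_set] unfolding num_vars_def by simp
next
  case (Suc n)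
  note F = Suc.prems(1)
  show ?case
  proof (cases "sing_lits F = {}")
    case True
    then show ?thesis using base Suc.prems by simp
  next
    case False
    then obtain v where v: "ldeg F v = 1" unfolding sing_lits_def by auto
    have vF: "v \<in> \<Union>F" using ldeg_pos[OF F, of v] v by simp
    have min: "ldeg F v \<le> ldeg F l" if "l \<in> \<Union>F" for l using ldeg_pos[OF F, of l] v that by simp
    have v0: "v \<noteq> 0" using uhit_lit_nonzero[OF F vF] .
    let ?T = "restr v F"
    have T: "uhit ?T" using uhit_restr[OF F v0] .
    note dT = deficiency_restr[OF F vF min]
    have lt: "card (sing_lits ?T) < card (sing_lits F)" using card_sing_lits_restr[OF F v] .
    show ?thesis
    proof (cases "vars ?T = {}")
      case False
      have "int (num_vars ?T) \<le> 4 * d - 5 + int (card (sing_lits ?T))"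
        using Suc.hyps(1)[OF _ T False] Suc.hyps(2) Suc.prems dT v by simp
      then show ?thesis using dT lt by linarith
    next
      case True
      \<comment> \<open>Here \<open>v\<close> was the last variable, and both its literals have
        degree one. With \<open>d = 1\<close> the bound 4 - 5 + 2 is attained exactly.\<close>
      then have "\<Union>?T \<subseteq> {}" unfolding vars_eq by blast
      then have "K = {- v}" if "K \<in> F" "- v \<in> K" for K
        using that clauseD(3)[OF uhit_clause[OF F that(1)]] unfolding restr_def by fastforce
      moreover obtain M where "M \<in> F" "- v \<in> M" using uhit_complement_occurs[OF F vF] by blast
      ultimately have "{K \<in> F. - v \<in> K} = {M}" by blast
      then have "{v, - v} \<subseteq> sing_lits F" using v unfolding sing_lits_def ldeg_def by simp
      then have "card {v, - v} \<le> card (sing_lits F)" using finite_sing_lits[OF F] by (rule card_mono[rotated])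
      then have "2 \<le> card (sing_lits F)" using v0 by simp
      moreover have "num_vars F = 1" using dT True unfolding num_vars_def by simp
      moreover have "1 \<le> d" using deficiency_pos[OF F] Suc.prems by simp
      ultimately show ?thesis by linarith
    qed
  qed
qed

text \<open>The minimal literal degree is at least two and bounded by the deficiency. Thus the
  premise \<open>base\<close> of \<open>num_vars_le_sing_lits\<close> holds vacuously for deficiency
  one.\<close>

lemma nonsingular_deficiency:
  assumes "uhit F" "sing_lits F = {}" "vars F \<noteq> {}"
  shows "2 \<le> deficiency F"
proof -
  obtain v where v: "v \<in> \<Union>F" "\<And>l. l \<in> \<Union>F \<Longrightarrow> ldeg F v \<le> ldeg F l"
    using ex_min_literal[OF assms(1,3)] by blast
  have "0 < ldeg F v" using ldeg_pos[OF assms(1)] v(1) by blast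
  moreover have "ldeg F v \<noteq> 1" using assms(2) unfolding sing_lits_def by blast
  ultimately have "2 \<le> ldeg F v" by linarith
  then show ?thesis using min_degree_le_deficiency[OF assms(1) v] by linarith
qed

section \<open>Deficiency two\<close>

text \<open>The cubes falsified by the clauses containing \<open>- v\<close> tile the union of the two cubes falsified by
  \<open>A\<close> and \<open>B\<close>; a cube inside the union of two disjoint cubes lies in one of them or spans both along a
  single direction \<open>w\<close>.\<close>

lemma degree_two_cover:
  assumes F: "uhit F" and AB: "{K \<in> F. v \<in> K} = {A, B}" and D: "D \<in> F" "- v \<in> D"
  shows "A - {v} \<subseteq> D \<or> B - {v} \<subseteq> D \<or> (\<exists>w. A \<subseteq> insert v (insert w D) \<and> B \<subseteq> insert v (insert (- w) D))"
proof -
  have AF: "A \<in> F" "v \<in> A" and BF: "B \<in> F" "v \<in> B" using AB by blast+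
  \<comment> \<open>If \<open>a\<close> and \<open>b\<close> could both be true while
    \<open>D\<close> is falsified, flipping \<open>v\<close> would lead to a clause with
    \<open>v\<close> that is neither \<open>A\<close> nor \<open>B\<close>. Only a conflict between
    \<open>a\<close> and \<open>b\<close> prevents this.\<close>
  have opp: "b = - a" if ab: "a \<in> A" "a \<noteq> v" "a \<notin> D" "b \<in> B" "b \<noteq> v" "b \<notin> D" for a b
  proof (rule ccontr)
    assume ne: "b \<noteq> - a"
    have "a \<noteq> 0" "b \<noteq> 0" using uhit_lit_nonzero[OF F] AF BF ab by blast+
    then obtain S where S: "total_assignment S" "a \<in> S" "b \<in> S" "D \<inter> S = {}"
      using ex_falsifying_with2[OF uhit_clause[OF F D(1)]] ab ne by metis
    obtain K where K: "K \<in> F" "v \<in> K" "K \<inter> set_true (- v) S = {}"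
      using uhit_flip[OF F D S(1,4)] by auto
    have "K \<in> {A, B}" unfolding AB[symmetric] using K by simp
    moreover have "a \<in> set_true (- v) S" "b \<in> set_true (- v) S"
      using S ab unfolding set_true_def by simp_all
    ultimately show False using K(3) ab by blast
  qed
  show ?thesis
  proof (cases "A - {v} \<subseteq> D \<or> B - {v} \<subseteq> D")
    case False
    then obtain a b where ab: "a \<in> A" "a \<noteq> v" "a \<notin> D" "b \<in> B" "b \<noteq> v" "b \<notin> D" by blast
    have "c = a" if "c \<in> A" "c \<noteq> v" "c \<notin> D" for c
      using opp[OF that ab(4-6)] opp[OF ab] by simp
    moreover have "c = - a" if "c \<in> B" "c \<noteq> v" "c \<notin> D" for c
      using opp[OF ab(1-3) that] .
    ultimately show ?thesis by blast
  qed blast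
qed

text \<open>From an assignment falsifying \<open>B\<close>, flipping \<open>v\<close> leads to a
  clause with \<open>- v\<close>. Were \<open>A - {v}\<close> contained in it, the original
  assignment would falsify \<open>A\<close> too.\<close>

lemma ex_clause_not_above:
  assumes F: "uhit F" and A: "A \<in> F" "v \<in> A" and B: "B \<in> F" "v \<in> B" and "A \<noteq> B"
  shows "\<exists>D\<in>F. - v \<in> D \<and> \<not> A - {v} \<subseteq> D"
proof -
  obtain S where S: "total_assignment S" "B \<inter> S = {}" using ex_falsifying[OF uhit_clause[OF F B(1)]] by blast
  obtain K where K: "K \<in> F" "- v \<in> K" "K \<inter> set_true v S = {}" using uhit_flip[OF F B S] by blast
  have "\<not> A - {v} \<subseteq> K"
  proof
    assume sub: "A - {v} \<subseteq> K"
    have "- v \<notin> A" using clauseD(3)[OF uhit_clause[OF F A(1)] A(2)] .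
    then have "A \<inter> S = {}" using K(3) sub S(2) B(2) unfolding set_true_def by blast
    then show False using uhit_unique[OF F S(1) A(1) B(1) _ S(2)] \<open>A \<noteq> B\<close> by blast
  qed
  then show ?thesis using K by blast
qed

text \<open>Four variables would leave at least four literals of degree one after setting a literal
  \<open>v\<close> of degree two to true. All of them lie in the two lost clauses, while each clause
  with \<open>- v\<close> holds at most one of them; the covering lemma makes these facts
  incompatible.\<close>

lemma num_vars_deficiency_two:
  assumes F: "uhit F" and ns: "sing_lits F = {}" and def2: "deficiency F = 2"
  shows "num_vars F \<le> 3"
proof (rule ccontr)
  assume "\<not> num_vars F \<le> 3"
  then have n4: "4 \<le> num_vars F" by simp
  then have "vars F \<noteq> {}" unfolding num_vars_def by auto
  then obtain v where v: "v \<in> \<Union>F" "\<And>l. l \<in> \<Union>F \<Longrightarrow> ldeg F v \<le> ldeg F l"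
    using ex_min_literal[OF F] by blast
  have v0: "v \<noteq> 0" using uhit_lit_nonzero[OF F v(1)] .
  have "0 < ldeg F v" using ldeg_pos[OF F] v(1) by blast
  moreover have "ldeg F v \<noteq> 1" using ns unfolding sing_lits_def by blast
  moreover have "int (ldeg F v) \<le> 2" using min_degree_le_deficiency[OF F v] def2 by simp
  ultimately have deg: "ldeg F v = 2" by linarith
  let ?T = "restr v F"
  let ?L = "sing_lits ?T"
  have T: "uhit ?T" using uhit_restr[OF F v0] .
  have dT: "deficiency ?T = 1" "3 \<le> num_vars ?T"
    using deficiency_restr[OF F v] deg def2 n4 by simp_all
  then have "vars ?T \<noteq> {}" unfolding num_vars_def by auto
  then have "int (num_vars ?T) \<le> 4 * 1 - 5 + int (card ?L)"
    using nonsingular_deficiency dT(1) by (intro num_vars_le_sing_lits[OF _ T]) fastforce+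
  \<comment> \<open>In deficiency one the bound reads n \<le> |L| - 1, so three variables force four
    literals.\<close>
  then have L4: "4 \<le> card ?L" using dT(2) by linarith
  have Lfin: "finite ?L" using finite_sing_lits[OF T] .
  have Lne: "l \<noteq> v \<and> l \<noteq> - v" if "l \<in> ?L" for l
    using sing_lits_subset[OF T] lits_restr[of v F] that by blast
  obtain A B where AB: "{K \<in> F. v \<in> K} = {A, B}" "A \<noteq> B"
    using deg unfolding ldeg_def by (auto simp: card_2_iff)
  have AF: "A \<in> F" "v \<in> A" and BF: "B \<in> F" "v \<in> B" using AB(1) by blast+
  \<comment> \<open>A literal outside both lost clauses keeps its degree, which is not one in
    \<open>F\<close>.\<close>
  have LAB: "?L \<subseteq> A \<union> B"
  proof
    fix l assume l: "l \<in> ?L"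
    show "l \<in> A \<union> B"
    proof (rule ccontr)
      assume nl: "l \<notin> A \<union> B"
      have "v \<notin> K" if "K \<in> F" "l \<in> K" for K
      proof
        assume "v \<in> K"
        then have "K \<in> {A, B}" unfolding AB(1)[symmetric] using that by simp
        then show False using nl that by blast
      qed
      then have "{K \<in> F. v \<notin> K \<and> l \<in> K} = {K \<in> F. l \<in> K}" by blast
      then have "l \<in> sing_lits F" using l ldeg_restr[OF F, of l v] Lne[OF l]
        unfolding sing_lits_def ldeg_def by simp
      then show False using ns by blast
    qed
  qed
  have one: "card (?L \<inter> D) \<le> 1" if D: "D \<in> F" "- v \<in> D" for D
  proof -
    have "v \<notin> D" using clauseD(3)[OF uhit_clause[OF F D(1)] D(2)] by simp
    then have DT: "D - {- v} \<in> ?T" using D unfolding restr_def by blast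
    have "l = m" if "l \<in> ?L \<inter> D" "m \<in> ?L \<inter> D" for l m
      using singular_lits_in_clause[OF T DT, of l m] that Lne unfolding sing_lits_def by blast
    then show ?thesis using Lfin card_le_Suc0_iff_eq[of "?L \<inter> D"] by simp
  qed
  have one': "card (?L \<inter> X) \<le> 1" if "D \<in> F" "- v \<in> D" "X - {v} \<subseteq> D" for D X
  proof -
    have "?L \<inter> X \<subseteq> ?L \<inter> D" using that(3) Lne by blast
    then have "card (?L \<inter> X) \<le> card (?L \<inter> D)" using Lfin by (intro card_mono) auto
    then show ?thesis using one[OF that(1,2)] by simp
  qed
  obtain D1 where D1: "D1 \<in> F" "- v \<in> D1" "\<not> A - {v} \<subseteq> D1"
    using ex_clause_not_above[OF F AF BF AB(2)] by blast
  obtain D2 where D2: "D2 \<in> F" "- v \<in> D2" "\<not> B - {v} \<subseteq> D2"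
    using ex_clause_not_above[OF F BF AF AB(2)[symmetric]] by blast
  show False
  proof (cases "B - {v} \<subseteq> D1")
    case True
    have "?L = (?L \<inter> A) \<union> (?L \<inter> B)" using LAB by blast
    then have "card ?L \<le> card (?L \<inter> A) + card (?L \<inter> B)" by (metis card_Un_le)
    \<comment> \<open>\<open>B\<close> contributes at most one literal, so \<open>A\<close> has at
      least three; but \<open>A\<close> exceeds \<open>D2\<close> only by \<open>v\<close> and one
      further literal \<open>w\<close>, which allows two.\<close>
    then have A3: "3 \<le> card (?L \<inter> A)" using one'[OF D1(1,2) True] L4 by linarith
    then have "\<not> A - {v} \<subseteq> D2" using one'[OF D2(1,2), of A] by linarith
    then obtain w where "A \<subseteq> insert v (insert w D2)"
      using degree_two_cover[OF F AB(1) D2(1,2)] D2(3) by blast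
    then have "?L \<inter> A \<subseteq> insert w (?L \<inter> D2)" using Lne by blast
    then have "card (?L \<inter> A) \<le> card (insert w (?L \<inter> D2))" using Lfin by (intro card_mono) auto
    also have "\<dots> \<le> Suc (card (?L \<inter> D2))" using Lfin by (simp add: card_insert_if)
    finally show False using A3 one[OF D2(1,2)] by linarith
  next
    case False
    then obtain w where "A \<subseteq> insert v (insert w D1)" "B \<subseteq> insert v (insert (- w) D1)"
      using degree_two_cover[OF F AB(1) D1(1,2)] D1(3) by blast
    \<comment> \<open>Both lost clauses exceed \<open>D1\<close> only in the direction of
      \<open>w\<close>, so there are at most 1 + 2 such literals.\<close>
    then have "?L \<subseteq> (?L \<inter> D1) \<union> {w, - w}" using Lne LAB by blast
    then have "card ?L \<le> card ((?L \<inter> D1) \<union> {w, - w})" using Lfin by (intro card_mono) auto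
    also have "\<dots> \<le> card (?L \<inter> D1) + card {w, - w}" by (rule card_Un_le)
    also have "\<dots> \<le> 1 + 2" using one[OF D1(1,2)] by (intro add_mono) (auto simp: card_insert_if)
    finally show False using L4 by simp
  qed
qed

section \<open>Clause-factors\<close>

definition residue :: "int set set \<Rightarrow> int set set" where
  "residue F' = (\<lambda>C. C - \<Inter>F') ` F'"

text \<open>The clauses of a factor tile exactly the subcube falsified by \<open>\<Inter>F'\<close>,
  which permits merging them into that one clause.\<close>

definition contraction :: "int set set \<Rightarrow> int set set \<Rightarrow> int set set" where
  "contraction F F' = insert (\<Inter>F') (F - F')"

context
  fixes F F' :: "int set set"
  assumes F: "uhit F" and sub: "F' \<subseteq> F" and fac: "clause_factor F'"
begin

lemma inj_on_residue: "inj_on (\<lambda>C. C - \<Inter>F') F'"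
proof (rule inj_onI)
  fix C D assume "C \<in> F'" "D \<in> F'" "C - \<Inter>F' = D - \<Inter>F'"
  then show "C = D" by (metis Diff_partition Inter_lower)
qed

text \<open>A literal in which two clauses of \<open>F'\<close> clash is not common to all of
  \<open>F'\<close>, so clashes survive the removal of the common part.\<close>

lemma uhit_residue: "uhit (residue F')"
  unfolding uhit_def
proof (intro conjI)
  show "clause_set (residue F')"
    using fac clause_subset[OF _ Diff_subset]
    unfolding clause_factor_def clause_set_def residue_def by blast
  have "{C - \<Inter>F' | C. C \<in> F'} = residue F'" unfolding residue_def by blast
  then show "unsatisfiable (residue F')" using fac unfolding clause_factor_def by simp
  show "hitting (residue F')"
    unfolding hitting_def
  proof (intro ballI impI)
    fix C' D' assume CD': "C' \<in> residue F'" "D' \<in> residue F'" "C' \<noteq> D'"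
    then obtain C D where CD: "C \<in> F'" "C' = C - \<Inter>F'" "D \<in> F'" "D' = D - \<Inter>F'"
      unfolding residue_def by blast
    then have "C \<noteq> D" using CD' by blast
    then obtain x where x: "x \<in> C" "- x \<in> D" using uhit_clash[OF F] CD sub by blast
    have "clause C" "clause D" using uhit_clause[OF F] CD sub by blast+
    then have "x \<notin> D" "- x \<notin> C" using clauseD(3)[of D "- x"] clauseD(3)[of C x] x by simp_all
    then have "x \<notin> \<Inter>F'" "- x \<notin> \<Inter>F'" using CD by blast+
    then show "\<exists>x\<in>C'. - x \<in> D'" using x CD by blast
  qed
qed

lemma factor_falsified:
  assumes "total_assignment S" "\<Inter>F' \<inter> S = {}"
  shows "\<exists>C\<in>F'. C \<inter> S = {}"
proof -
  obtain C where C: "C \<in> F'" "(C - \<Inter>F') \<inter> S = {}"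
    using uhit_ex[OF uhit_residue assms(1)] unfolding residue_def by auto
  have "K \<inter> S = {}" if "(K - X) \<inter> S = {}" "X \<inter> S = {}" for K X :: "int set" using that by blast
  then show ?thesis using C assms(2) by blast
qed

lemma factor_nonempty: "F' \<noteq> {}"
  using fac unfolding clause_factor_def by blast

lemma clause_Inter_factor: "clause (\<Inter>F')"
proof -
  obtain C where "C \<in> F'" using factor_nonempty by blast
  then show ?thesis using clause_subset[of C "\<Inter>F'"] uhit_clause[OF F] sub by blast
qed

text \<open>Falsifying \<open>\<Inter>F'\<close> falsifies a clause of \<open>F'\<close>, so an
  outside clause equal to \<open>\<Inter>F'\<close> would be falsified at the same time. This makes
  the clause count of the contraction exact.\<close>

lemma Inter_factor_notin: "\<Inter>F' \<notin> F - F'"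
proof
  assume a: "\<Inter>F' \<in> F - F'"
  obtain S where S: "total_assignment S" "\<Inter>F' \<inter> S = {}" using ex_falsifying[OF clause_Inter_factor] by blast
  obtain C where C: "C \<in> F'" "C \<inter> S = {}" using factor_falsified[OF S] by blast
  then have "C = \<Inter>F'" using uhit_unique[OF F S(1) _ _ C(2) S(2)] sub a by blast
  then show False using a C by blast
qed

lemma uhit_contraction: "uhit (contraction F F')"
  unfolding uhit_iff
proof (intro conjI allI impI)
  show "clause_set (contraction F F')"
    using uhit_clause_set[OF F] clause_Inter_factor
    unfolding clause_set_def contraction_def by blast
  fix S assume S: "total_assignment S"
  show "\<exists>!D. D \<in> contraction F F' \<and> D \<inter> S = {}"
  proof (cases "\<Inter>F' \<inter> S = {}")
    case True
    then obtain C where C: "C \<in> F'" "C \<inter> S = {}" using factor_falsified[OF S] by blast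
    have "D \<inter> S \<noteq> {}" if "D \<in> F - F'" for D
    proof
      assume "D \<inter> S = {}"
      then have "D = C" using uhit_unique[OF F S _ _ _ C(2)] sub C(1) that by blast
      then show False using C that by blast
    qed
    then show ?thesis using True unfolding contraction_def by (intro ex1I[of _ "\<Inter>F'"]) auto
  next
    case False
    obtain D where D: "D \<in> F" "D \<inter> S = {}" using uhit_ex[OF F S] by blast
    have "\<Inter>F' \<subseteq> D" if "D \<in> F'" using that by (rule Inter_lower)
    then have "D \<notin> F'" using D(2) False by (meson disjoint_iff subsetD)
    show ?thesis
    proof (rule ex1I)
      show "D \<in> contraction F F' \<and> D \<inter> S = {}"
        using D \<open>D \<notin> F'\<close> unfolding contraction_def by simp
      fix K assume K: "K \<in> contraction F F' \<and> K \<inter> S = {}"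
      then have "K \<noteq> \<Inter>F'" using False by metis
      then have "K \<in> F" using K unfolding contraction_def by simp
      then show "K = D" using uhit_unique[OF F S _ D(1) _ D(2)] K by simp
    qed
  qed
qed

lemma vars_factor: "vars F = vars (residue F') \<union> vars (contraction F F')"
proof -
  define I where "I = \<Inter>F'"
  have I: "I \<subseteq> C" if "C \<in> F'" for C using that unfolding I_def by (rule Inter_lower)
  have "\<Union>F = \<Union>(residue F') \<union> \<Union>(contraction F F')"
    using sub factor_nonempty I unfolding residue_def contraction_def I_def[symmetric] by blast
  then show ?thesis unfolding vars_eq by (simp add: image_Un)
qed

lemma card_residue: "card (residue F') = card F'"
  unfolding residue_def by (rule card_image[OF inj_on_residue])

lemma card_factor: "Suc (card F) = card (residue F') + card (contraction F F')"
proof -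
  have fin: "finite F" using uhit_finite[OF F] .
  then have "card (contraction F F') = Suc (card (F - F'))"
    unfolding contraction_def using Inter_factor_notin by simp
  moreover have "card (F - F') = card F - card F'" using sub fin by (metis card_Diff_subset finite_subset)
  moreover have "card F' \<le> card F" using sub fin by (rule card_mono[rotated])
  ultimately show ?thesis using card_residue by simp
qed

lemma sing_lits_residue:
  assumes "l \<in> sing_lits (residue F')" "\<bar>l\<bar> \<notin> vars (contraction F F')"
  shows "l \<in> sing_lits F"
proof -
  define I where "I = \<Inter>F'"
  have "l \<notin> \<Union>(contraction F F')" using assms(2) unfolding vars_eq by blast
  then have "l \<notin> I" and sF: "{K \<in> F. l \<in> K} \<subseteq> F'"
    unfolding contraction_def I_def[symmetric] by blast+
  then have "{C \<in> residue F'. l \<in> C} = (\<lambda>C. C - I) ` {K \<in> F. l \<in> K}"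
    using sub unfolding residue_def I_def[symmetric] by blast
  then have "ldeg (residue F') l = ldeg F l"
    unfolding ldeg_def I_def using inj_on_subset[OF inj_on_residue sF] by (simp add: card_image)
  then show ?thesis using assms(1) unfolding sing_lits_def by simp
qed

text \<open>Literals of \<open>\<Inter>F'\<close> are excluded because merging can lower their
  degree to one.\<close>

lemma sing_lits_contraction:
  assumes "l \<in> sing_lits (contraction F F')" "\<bar>l\<bar> \<notin> vars (residue F')" "l \<notin> \<Inter>F'"
  shows "l \<in> sing_lits F"
proof -
  define I where "I = \<Inter>F'"
  have "l \<notin> \<Union>(residue F')" using assms(2) unfolding vars_eq by blast
  then have "l \<notin> K" if "K \<in> F'" for K
    using that assms(3) unfolding residue_def I_def[symmetric] by blast
  then have "{C \<in> contraction F F'. l \<in> C} = {K \<in> F. l \<in> K}"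
    using assms(3) unfolding contraction_def I_def[symmetric] by blast
  then show ?thesis using assms(1) unfolding sing_lits_def ldeg_def by simp
qed

end

section \<open>The variable bound obtained from a nontrivial factor\<close>

lemma vars_nonempty:
  assumes "2 \<le> card F"
  shows "vars F \<noteq> {}"
proof
  assume "vars F = {}"
  then have "F \<subseteq> {{}}" unfolding vars_eq by blast
  then have "card F \<le> card {{} :: int set}" by (intro card_mono) auto
  then show False using assms by simp
qed

text \<open>Both parts obey the bound with their numbers of degree-one literals, and the two bounds
  add up. The premise \<open>shared\<close> ensures that both parts have smaller deficiency than
  \<open>F\<close>, so that \<open>bound\<close> applies to them.\<close>

lemma num_vars_factor_le:
  assumes F: "uhit F" and sub: "F' \<subseteq> F" "F' \<noteq> F" and fac: "clause_factor F'" and two: "2 \<le> card F'"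
    and bound: "\<And>H. uhit H \<Longrightarrow> sing_lits H = {} \<Longrightarrow> vars H \<noteq> {} \<Longrightarrow> deficiency H < deficiency F \<Longrightarrow>
      int (num_vars H) \<le> 4 * deficiency H - 5"
    and shared: "sing_lits F = {} \<or> vars (residue F') \<inter> vars (contraction F F') \<noteq> {}"
  shows "int (num_vars F) + int (card (vars (residue F') \<inter> vars (contraction F F')))
    \<le> 4 * deficiency F - 5 + int (card (sing_lits F))"
proof -
  let ?R = "residue F'" and ?Q = "contraction F F'"
  define V where "V = vars ?R \<inter> vars ?Q"
  have R: "uhit ?R" and Q: "uhit ?Q"
    using uhit_residue[OF F sub(1) fac] uhit_contraction[OF F sub(1) fac] .
  have finR: "finite (vars ?R)" and finQ: "finite (vars ?Q)"
    using finite_vars uhit_clause_set R Q by blast+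
  then have finV: "finite V" unfolding V_def by blast
  have finL: "finite (sing_lits F)" "finite (sing_lits ?R)" "finite (sing_lits ?Q)"
    using finite_sing_lits F R Q by blast+
  have n: "num_vars F + card V = num_vars ?R + num_vars ?Q"
    unfolding num_vars_def V_def vars_factor[OF F sub(1) fac]
    using card_Un_Int[OF finR finQ] by simp
  then have def: "deficiency ?R + deficiency ?Q = deficiency F + 1 - int (card V)"
    using card_factor[OF F sub(1) fac] unfolding deficiency_def num_clauses_def by linarith
  have cR: "2 \<le> card ?R" using two card_residue[OF F sub(1) fac] by simp
  have "card F' < card F" using sub uhit_finite[OF F] by (simp add: psubset_card_mono psubset_eq)
  then have cQ: "2 \<le> card ?Q"
    using card_factor[OF F sub(1) fac] card_residue[OF F sub(1) fac] by linarith
  have vR: "vars ?R \<noteq> {}" and vQ: "vars ?Q \<noteq> {}" using vars_nonempty cR cQ by blast+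
  \<comment> \<open>A degree-one literal of either part that is new either lies over a shared
    variable, at most 2 s per part, or belongs to \<open>\<Inter>F'\<close>.\<close>
  define V2 where "V2 = V \<union> uminus ` V"
  have V2: "finite V2" "card V2 \<le> 2 * card V"
    unfolding V2_def using finV card_Un_le[of V "uminus ` V"] card_image_le[OF finV, of uminus] by auto
  have inV2: "l \<in> V2" if "\<bar>l\<bar> \<in> vars ?R" "\<bar>l\<bar> \<in> vars ?Q" for l
  proof -
    have "\<bar>l\<bar> \<in> V" unfolding V_def using that by blast
    moreover have "l = \<bar>l\<bar> \<or> l = - \<bar>l\<bar>" by linarith
    ultimately show ?thesis unfolding V2_def by (metis UnI1 UnI2 imageI)
  qed
  define L1 where "L1 = {l \<in> sing_lits F. \<bar>l\<bar> \<notin> vars ?Q}"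
  define L2 where "L2 = {l \<in> sing_lits F. \<bar>l\<bar> \<notin> vars ?R}"
  have finL12: "finite L1" "finite L2" unfolding L1_def L2_def using finL by auto
  have "\<bar>l\<bar> \<in> vars ?R \<union> vars ?Q" if "l \<in> sing_lits F" for l
    using that sing_lits_subset[OF F] vars_factor[OF F sub(1) fac] unfolding vars_eq by blast
  then have "L1 \<inter> L2 = {}" "L1 \<union> L2 \<subseteq> sing_lits F" unfolding L1_def L2_def by blast+
  then have L12: "card L1 + card L2 \<le> card (sing_lits F)"
    using card_Un_disjoint[OF finL12] card_mono[OF finL(1)] by metis
  have occ: "\<bar>l\<bar> \<in> vars H" if "uhit H" "l \<in> sing_lits H" for H l
    using that sing_lits_subset unfolding vars_eq by blast
  have subR: "sing_lits ?R \<subseteq> V2 \<union> L1"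
    using sing_lits_residue[OF F sub(1) fac] inV2 occ[OF R] unfolding L1_def by blast
  have subQ: "sing_lits ?Q \<subseteq> V2 \<union> (sing_lits ?Q \<inter> \<Inter>F') \<union> L2"
    using sing_lits_contraction[OF F sub(1) fac] inV2 occ[OF Q] unfolding L2_def by blast
  have IQ: "\<Inter>F' \<in> ?Q" unfolding contraction_def by blast
  \<comment> \<open>\<open>\<Inter>F'\<close> is itself a clause of the contraction, so it contains
    at most one of its degree-one literals; this is the + 1 in \<open>LQ\<close>.\<close>
  have "l = m" if "l \<in> sing_lits ?Q \<inter> \<Inter>F'" "m \<in> sing_lits ?Q \<inter> \<Inter>F'" for l m
    using singular_lits_in_clause[OF Q IQ, of l m] that unfolding sing_lits_def by blast
  then have one: "card (sing_lits ?Q \<inter> \<Inter>F') \<le> 1"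
    using finL(3) card_le_Suc0_iff_eq[of "sing_lits ?Q \<inter> \<Inter>F'"] by simp
  have LR: "card (sing_lits ?R) \<le> 2 * card V + card L1"
    using card_mono[OF _ subR] card_Un_le[of V2 L1] V2 finL12 by force
  have "card (sing_lits ?Q) \<le> card (V2 \<union> (sing_lits ?Q \<inter> \<Inter>F') \<union> L2)"
    using card_mono[OF _ subQ] V2 finL12 finL by blast
  also have "\<dots> \<le> card V2 + card (sing_lits ?Q \<inter> \<Inter>F') + card L2"
    using card_Un_le[of "V2 \<union> (sing_lits ?Q \<inter> \<Inter>F')" L2] card_Un_le[of V2 "sing_lits ?Q \<inter> \<Inter>F'"] by linarith
  finally have LQ: "card (sing_lits ?Q) \<le> 2 * card V + 1 + card L2" using V2 one by linarith
  \<comment> \<open>With shared variables, positivity of both deficiencies suffices. Otherwise both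
    must be at least two: the residue is nonsingular, and the contraction has at most one degree-one
    literal, which in deficiency one leaves no variable.\<close>
  have "deficiency ?R < deficiency F \<and> deficiency ?Q < deficiency F"
  proof (cases "V = {}")
    case False
    then have "0 < card V" using finV by (simp add: card_gt_0_iff)
    then show ?thesis using def deficiency_pos[OF R] deficiency_pos[OF Q] by linarith
  next
    case True
    then have "sing_lits F = {}" using shared unfolding V_def by blast
    then have L0: "card L1 = 0" "card L2 = 0" using L12 by simp_all
    then have "sing_lits ?R = {}" using LR True finL by simp
    then have "2 \<le> deficiency ?R" using nonsingular_deficiency[OF R] vR by blast
    moreover have "deficiency ?Q \<noteq> 1"
    proof
      assume "deficiency ?Q = 1"
      then have "int (num_vars ?Q) \<le> 4 * 1 - 5 + int (card (sing_lits ?Q))"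
        using nonsingular_deficiency by (intro num_vars_le_sing_lits[OF _ Q vQ]) fastforce+
      then have "num_vars ?Q = 0" using LQ L0 True by simp
      then show False using vQ finQ unfolding num_vars_def by simp
    qed
    ultimately show ?thesis using def True deficiency_pos[OF Q] by simp
  qed
  then have "int (num_vars ?R) \<le> 4 * deficiency ?R - 5 + int (card (sing_lits ?R))"
    and "int (num_vars ?Q) \<le> 4 * deficiency ?Q - 5 + int (card (sing_lits ?Q))"
    using num_vars_le_sing_lits[OF _ R vR refl] num_vars_le_sing_lits[OF _ Q vQ refl] bound by metis+
  \<comment> \<open>With s shared variables this is 4 (\<delta> + 1 - s) - 10 + (4 s + 1 + |L|) - s
    = 4 \<delta> - 5 + |L| - s.\<close>
  then show ?thesis using n def LR LQ L12 unfolding V_def[symmetric] by linarith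
qed

lemma reducible_num_vars_le:
  assumes F: "uhit F" and ns: "sing_lits F = {}" and red: "clause_reducible F"
    and bound: "\<And>H. uhit H \<Longrightarrow> sing_lits H = {} \<Longrightarrow> vars H \<noteq> {} \<Longrightarrow> deficiency H < deficiency F \<Longrightarrow>
      int (num_vars H) \<le> 4 * deficiency H - 5"
  shows "int (num_vars F) \<le> 4 * deficiency F - 5"
proof -
  obtain F' where F': "F' \<subseteq> F" "clause_factor F'" "\<not> trivial_clause_factor F' F"
    using red unfolding clause_reducible_def clause_irreducible_def clause_factor_of_def by blast
  have ne: "F' \<noteq> F" using F'(3) F unfolding trivial_clause_factor_def uhit_def by blast
  have two: "2 \<le> card F'"
  proof -
    have "card F' \<noteq> 1" using F'(3) unfolding trivial_clause_factor_def num_clauses_def by blast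
    moreover have "0 < card F'" using F'(2) unfolding clause_factor_def clause_set_def
      by (simp add: card_gt_0_iff)
    ultimately show ?thesis by linarith
  qed
  have "int (num_vars F) + int (card (vars (residue F') \<inter> vars (contraction F F')))
      \<le> 4 * deficiency F - 5 + int (card (sing_lits F))"
    using num_vars_factor_le[OF F F'(1) ne F'(2) two] bound ns by blast
  then show ?thesis using ns by simp
qed

text \<open>An assignment falsifying the common part makes \<open>v\<close> true. Making
  \<open>v\<close> false falsifies \<open>C\<close>, the only clause with \<open>v\<close>, and
  going back falsifies a clause with \<open>- v\<close>; so these clauses cover the whole subcube of
  their common part.\<close>

lemma singular_clause_factor:
  assumes F: "uhit F" and deg: "ldeg F v = 1"
  shows "clause_factor {K \<in> F. - v \<in> K}" "{K \<in> F. - v \<in> K} \<noteq> F"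
proof -
  let ?F = "{K \<in> F. - v \<in> K}"
  have vF: "v \<in> \<Union>F" using ldeg_pos[OF F, of v] deg by simp
  then obtain C where C: "C \<in> F" "v \<in> C" by blast
  have v0: "v \<noteq> 0" using uhit_lit_nonzero[OF F vF] .
  have nvC: "- v \<notin> C" using clauseD(3)[OF uhit_clause[OF F C(1)] C(2)] .
  then show "?F \<noteq> F" using C by blast
  obtain M where M: "M \<in> ?F" using uhit_complement_occurs[OF F vF] by blast
  define I where "I = \<Inter>?F"
  have cI: "clause I"
    unfolding I_def using clause_subset[OF uhit_clause[OF F, of M] Inter_lower[OF M]] M by simp
  have CI: "C - {v} \<subseteq> I"
    unfolding I_def using singular_clause_subset[OF F deg C] by (intro Inter_greatest) simp
  have "- v \<in> I" unfolding I_def by simp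
  have "unsatisfiable {C - I | C. C \<in> ?F}"
    unfolding unsatisfiable_def satisfiable_def
  proof
    assume "\<exists>P. clause P \<and> (\<forall>D\<in>{C - I | C. C \<in> ?F}. P \<inter> D \<noteq> {})"
    then obtain P where P: "clause P" "\<forall>D\<in>{C - I | C. C \<in> ?F}. P \<inter> D \<noteq> {}" by (elim exE conjE)
    have "clause (P - I)" by (rule clause_subset[OF P(1) Diff_subset])
    then obtain S where S: "total_assignment S" "P - I \<subseteq> S" "I \<inter> S = {}"
      using ex_total_assignment[OF _ cI, of "P - I"] by blast
    have nvS: "- v \<notin> S" using S(3) \<open>- v \<in> I\<close> by blast
    then have vS: "v \<in> S" using S(1) v0 unfolding total_assignment_def by blast
    let ?S = "set_true (- v) S"
    have S': "total_assignment ?S" using total_set_true[OF S(1)] v0 by simp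
    have "C \<inter> insert (- v) (S - {v}) = {}" using CI S(3) nvC by blast
    then have "C \<inter> ?S = {}" unfolding set_true_def by simp
    then obtain K where K: "K \<in> F" "- v \<in> K" "K \<inter> set_true v ?S = {}"
      using uhit_flip[OF F C S'] by blast
    have "set_true v ?S = S" using vS nvS unfolding set_true_def by auto
    then have "K \<inter> S = {}" using K by simp
    then have empty: "P \<inter> (K - I) = {}" using S(2) by blast
    have mem: "K - I \<in> {C - I | C. C \<in> ?F}" using K(1,2) by blast
    show False using bspec[OF P(2) mem] empty by (rule notE)
  qed
  moreover have "clause_set ?F" using uhit_clause_set[OF F] unfolding clause_set_def by simp
  ultimately show "clause_factor ?F" using M unfolding clause_factor_def I_def by blast
qed

section \<open>Clause-irreducible clause-sets of deficiency at least two are nonsingular\<close>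

lemma clause_irreducibleD:
  "clause_irreducible F \<Longrightarrow> F' \<subseteq> F \<Longrightarrow> clause_factor F' \<Longrightarrow> card F' = 1 \<or> F' = F"
  unfolding clause_irreducible_def clause_factor_of_def trivial_clause_factor_def num_clauses_def
  by blast

text \<open>The clauses with \<open>- v\<close> form a proper factor, hence a single clause
  \<open>D\<close>. Then \<open>C\<close> and \<open>D\<close> differ only in the sign of
  \<open>v\<close> and form a factor with two clauses, so they are all of \<open>F\<close>, whose
  deficiency is too small.\<close>

lemma irreducible_nonsingular:
  assumes F: "uhit F" and irr: "clause_irreducible F" and def: "2 \<le> deficiency F"
  shows "sing_lits F = {}"
proof (rule ccontr)
  assume "sing_lits F \<noteq> {}"
  then obtain v where deg: "ldeg F v = 1" unfolding sing_lits_def by blast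
  let ?F = "{K \<in> F. - v \<in> K}"
  have vF: "v \<in> \<Union>F" using ldeg_pos[OF F, of v] deg by simp
  have v0: "v \<noteq> 0" using uhit_lit_nonzero[OF F vF] .
  have deg': "ldeg F (- v) = 1"
    using clause_irreducibleD[OF irr _ singular_clause_factor(1)[OF F deg]]
      singular_clause_factor(2)[OF F deg]
    unfolding ldeg_def by simp
  obtain C where C: "C \<in> F" "v \<in> C" using vF by blast
  obtain D where D: "D \<in> F" "- v \<in> D" using uhit_complement_occurs[OF F vF] by blast
  have nC: "- v \<notin> C" using clauseD(3)[OF uhit_clause[OF F C(1)] C(2)] .
  have nD: "v \<notin> D" using clauseD(3)[OF uhit_clause[OF F D(1)] D(2)] by simp
  have "C - {v} \<subseteq> D" using singular_clause_subset[OF F deg C D] .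
  moreover have "D - {- v} \<subseteq> C" using singular_clause_subset[OF F deg' D] C by simp
  ultimately have eq: "C - C \<inter> D = {v}" "D - C \<inter> D = {- v}" using C D nC nD by blast+
  have "{K - \<Inter>{C, D} | K. K \<in> {C, D}} = {C - C \<inter> D, D - C \<inter> D}" by auto
  then have res: "{K - \<Inter>{C, D} | K. K \<in> {C, D}} = {{v}, {- v}}" unfolding eq .
  have "unsatisfiable {{v}, {- v}}"
    unfolding unsatisfiable_def satisfiable_def
  proof
    assume "\<exists>P. clause P \<and> (\<forall>D\<in>{{v}, {- v}}. P \<inter> D \<noteq> {})"
    then obtain P where P: "clause P" "\<forall>D\<in>{{v}, {- v}}. P \<inter> D \<noteq> {}" by (elim exE conjE)
    have "v \<in> P" "- v \<in> P" using P(2) by simp_all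
    then show False using clauseD(3)[OF P(1)] by simp
  qed
  moreover have "clause_set {C, D}" using uhit_clause_set[OF F] C D unfolding clause_set_def by simp
  ultimately have "clause_factor {C, D}" unfolding clause_factor_def res by blast
  then have "card {C, D} = 1 \<or> {C, D} = F" using clause_irreducibleD[OF irr] C(1) D(1) by simp
  moreover have "C \<noteq> D" using C(2) nD by blast
  then have "card {C, D} = 2" by simp
  ultimately have "card F = 2" by auto
  moreover have "vars F \<noteq> {}" using vF unfolding vars_eq by blast
  then have "0 < num_vars F"
    using finite_vars[OF uhit_clause_set[OF F]] unfolding num_vars_def by (simp add: card_gt_0_iff)
  ultimately show False using def unfolding deficiency_def num_clauses_def by simp
qed

section \<open>Flips\<close>

lemma clause_insert:
  assumes "clause C" "u \<noteq> 0" "- u \<notin> C"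
  shows "clause (insert u C)"
  unfolding clause_def
proof (intro conjI ballI)
  show "finite (insert u C)" "0 \<notin> insert u C" using clauseD(1,2)[OF assms(1)] assms(2) by simp_all
  fix x assume x: "x \<in> insert u C"
  show "- x \<notin> insert u C"
  proof (cases "x = u")
    case True
    then show ?thesis using assms(2,3) by simp
  next
    case False
    then have "x \<in> C" using x by simp
    moreover have "- x \<noteq> u" using assms(3) \<open>x \<in> C\<close> by (metis minus_minus)
    ultimately show ?thesis using clauseD(3)[OF assms(1)] by simp
  qed
qed

lemma nfs_flip_facts:
  assumes F: "uhit F" and flip: "nfs_flip F G"
  obtains x y E where "x \<noteq> 0" "x \<notin> E \<union> {y}" "E \<union> {x, - y} \<in> G" "E \<union> {y} \<in> G" "x \<in> \<Union>F"
    "uhit G" "vars G = vars F" "card G = card F" "\<And>l. l \<noteq> - x \<Longrightarrow> ldeg F l \<le> ldeg G l"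
proof -
  obtain P P' where PP: "nfs_pair_flip P P'" "P \<subseteq> F" "P' \<inter> F = {}" "G = (F - P) \<union> P'"
    using flip unfolding nfs_flip_def by (elim exE conjE)
  obtain E x y where E: "clause E" and xy: "x \<noteq> 0" "y \<noteq> 0" "\<bar>x\<bar> \<noteq> \<bar>y\<bar>"
      and notE: "x \<notin> E" "- x \<notin> E" "y \<notin> E" "- y \<notin> E"
      and P: "P = {E \<union> {x}, E \<union> {- x, y}}" and P': "P' = {E \<union> {x, - y}, E \<union> {y}}"
    using PP(1) unfolding nfs_pair_flip_def by (elim exE conjE)
  have ne: "x \<noteq> y" "x \<noteq> - y" "- x \<noteq> y" "x \<noteq> - x" "y \<noteq> - y" using xy by auto
  define P1 P2 Q1 Q2 where "P1 = E \<union> {x}" and "P2 = E \<union> {- x, y}" and "Q1 = E \<union> {x, - y}" and "Q2 = E \<union> {y}"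
  note defs = P1_def P2_def Q1_def Q2_def
  have PF: "P1 \<in> F" "P2 \<in> F" "Q1 \<notin> F" "Q2 \<notin> F" and G: "G = (F - {P1, P2}) \<union> {Q1, Q2}"
    using PP P P' unfolding defs by blast+
  have P12: "P1 \<noteq> P2"
  proof
    assume "P1 = P2"
    moreover have "x \<in> P1" "x \<notin> P2" unfolding defs using notE ne by simp_all
    ultimately show False by simp
  qed
  have Q12: "Q1 \<noteq> Q2"
  proof
    assume "Q1 = Q2"
    moreover have "x \<in> Q1" "x \<notin> Q2" unfolding defs using notE ne by simp_all
    ultimately show False by simp
  qed
  have cQ: "clause Q1" "clause Q2"
    using clause_insert[OF clause_insert[OF E, of "- y"], of x] clause_insert[OF E, of y] xy notE ne
    unfolding defs by simp_all
  \<comment> \<open>Some clause of either pair is falsified exactly when \<open>E\<close> is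
    falsified and \<open>x\<close>, \<open>y\<close> are not both true.\<close>
  have sem: "P1 \<inter> S = {} \<or> P2 \<inter> S = {} \<longleftrightarrow> Q1 \<inter> S = {} \<or> Q2 \<inter> S = {}"
    "\<not> (Q1 \<inter> S = {} \<and> Q2 \<inter> S = {})" if S: "total_assignment S" for S
  proof -
    have "x \<in> S \<longleftrightarrow> - x \<notin> S" "y \<in> S \<longleftrightarrow> - y \<notin> S" using S xy unfolding total_assignment_def by blast+
    then show "P1 \<inter> S = {} \<or> P2 \<inter> S = {} \<longleftrightarrow> Q1 \<inter> S = {} \<or> Q2 \<inter> S = {}"
      "\<not> (Q1 \<inter> S = {} \<and> Q2 \<inter> S = {})"
      unfolding defs by blast+
  qed
  have uG: "uhit G" unfolding uhit_iff
  proof (intro conjI allI impI)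
    show "clause_set G" using uhit_clause_set[OF F] cQ unfolding G clause_set_def by blast
    fix S assume S: "total_assignment S"
    obtain D where D: "D \<in> F" "D \<inter> S = {}" using uhit_ex[OF F S] by blast
    have uD: "K = D" if "K \<in> F" "K \<inter> S = {}" for K using uhit_unique[OF F S that(1) D(1) that(2) D(2)] .
    show "\<exists>!D. D \<in> G \<and> D \<inter> S = {}"
    proof (cases "D = P1 \<or> D = P2")
      case True
      then obtain Q where Q: "Q = Q1 \<or> Q = Q2" "Q \<inter> S = {}" using sem(1)[OF S] D(2) by metis
      show ?thesis
      proof (rule ex1I)
        show "Q \<in> G \<and> Q \<inter> S = {}" using Q unfolding G by blast
        fix K assume K: "K \<in> G \<and> K \<inter> S = {}"
        then have "K = Q1 \<or> K = Q2" using uD[of K] True unfolding G by blast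
        then show "K = Q" using sem(2)[OF S] K Q by metis
      qed
    next
      case False
      then have noP: "P1 \<inter> S \<noteq> {}" "P2 \<inter> S \<noteq> {}" using uD PF by metis+
      show ?thesis
      proof (rule ex1I)
        show "D \<in> G \<and> D \<inter> S = {}" using D False unfolding G by blast
        fix K assume K: "K \<in> G \<and> K \<inter> S = {}"
        then have "K \<noteq> Q1" "K \<noteq> Q2" using sem(1)[OF S] noP by metis+
        then show "K = D" using uD[of K] K unfolding G by blast
      qed
    qed
  qed
  have "abs ` (P1 \<union> P2) = abs ` (Q1 \<union> Q2)" unfolding defs by (simp add: image_Un insert_commute)
  moreover have "\<Union>F = \<Union>(F - {P1, P2}) \<union> (P1 \<union> P2)" "\<Union>G = \<Union>(F - {P1, P2}) \<union> (Q1 \<union> Q2)"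
    unfolding G using PF by blast+
  ultimately have vG: "vars G = vars F" unfolding vars_eq by (metis image_Un)
  \<comment> \<open>\<open>Q1\<close> contains \<open>P1\<close>, and \<open>Q2\<close> is
    \<open>P2\<close> without \<open>- x\<close>; matching them this way preserves every literal
    except \<open>- x\<close>.\<close>
  define f where "f K = (if K = P1 then Q1 else if K = P2 then Q2 else K)" for K
  have inj: "inj_on f F"
    using PF(3,4) P12 Q12 unfolding inj_on_def f_def by (auto split: if_splits)
  have fG: "f ` F = G"
  proof
    show "f ` F \<subseteq> G" unfolding G f_def by auto
    show "G \<subseteq> f ` F"
    proof
      fix K assume "K \<in> G"
      then consider "K \<in> F" "K \<noteq> P1" "K \<noteq> P2" | "K = Q1" | "K = Q2" unfolding G by blast
      then show "K \<in> f ` F"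
      proof cases
        case 1
        then have "f K = K" unfolding f_def by simp
        then show ?thesis using 1 by force
      next
        case 2
        then have "f P1 = K" unfolding f_def by simp
        then show ?thesis using PF by blast
      next
        case 3
        then have "f P2 = K" using P12 unfolding f_def by simp
        then show ?thesis using PF by blast
      qed
    qed
  qed
  have cG: "card G = card F" using card_image[OF inj] fG by simp
  have deg: "ldeg F l \<le> ldeg G l" if l: "l \<noteq> - x" for l
    unfolding ldeg_def
  proof (rule card_inj_on_le[of f])
    show "inj_on f {C \<in> F. l \<in> C}" by (rule inj_on_subset[OF inj]) blast
    have "l \<in> f K" if "l \<in> K" for K using that l unfolding f_def defs by auto
    then show "f ` {C \<in> F. l \<in> C} \<subseteq> {C \<in> G. l \<in> C}" using fG by blast
    show "finite {C \<in> G. l \<in> C}" using uhit_finite[OF uG] by simp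
  qed
  show ?thesis
  proof (rule that[of x E y])
    show "x \<noteq> 0" using xy by simp
    show "x \<notin> E \<union> {y}" using notE ne by simp
    show "E \<union> {x, - y} \<in> G" "E \<union> {y} \<in> G" unfolding G defs by blast+
    show "x \<in> \<Union>F" using PF(1) unfolding defs by blast
  qed (use uG vG cG deg in blast)+
qed

lemma deficiency_cong: "vars G = vars F \<Longrightarrow> card G = card F \<Longrightarrow> deficiency G = deficiency F"
  unfolding deficiency_def num_vars_def num_clauses_def by simp

text \<open>A flip lowers only the degree of \<open>- x\<close>. If this makes \<open>- x\<close> singular, the clauses containing \<open>x\<close>
  form a factor whose residue shares a variable with the flipped clause \<open>E \<union> {y}\<close> outside of it.\<close>

lemma flip_singular_num_vars_le:
  assumes F: "uhit F" and ns: "sing_lits F = {}" and flip: "nfs_flip F G" and sing: "sing_lits G \<noteq> {}"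
    and bound: "\<And>H. uhit H \<Longrightarrow> sing_lits H = {} \<Longrightarrow> vars H \<noteq> {} \<Longrightarrow> deficiency H < deficiency F \<Longrightarrow>
      int (num_vars H) \<le> 4 * deficiency H - 5"
  shows "int (num_vars F) \<le> 4 * deficiency F - 5"
proof -
  obtain x y E where x: "x \<noteq> 0" "x \<notin> E \<union> {y}" "E \<union> {x, - y} \<in> G" "E \<union> {y} \<in> G" "x \<in> \<Union>F"
    and G: "uhit G" "vars G = vars F" "card G = card F" and deg: "\<And>l. l \<noteq> - x \<Longrightarrow> ldeg F l \<le> ldeg G l"
    by (rule nfs_flip_facts[OF F flip], rule that)
  have dG: "deficiency G = deficiency F" using deficiency_cong G by blast
  have ge2: "2 \<le> ldeg F l" if "l \<in> \<Union>F" for l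
  proof -
    have "0 < ldeg F l" using ldeg_pos[OF F] that by blast
    moreover have "ldeg F l \<noteq> 1" using ns unfolding sing_lits_def by blast
    ultimately show ?thesis by linarith
  qed
  have "l = - x" if l: "l \<in> sing_lits G" for l
  proof (rule ccontr)
    assume "l \<noteq> - x"
    have "l \<in> \<Union>G" using sing_lits_subset[OF G(1)] l by blast
    then have "l \<in> \<Union>F" using uhit_abs_in_vars[OF F] uhit_abs_in_vars[OF G(1)] G(2) by metis
    then show False using ge2[of l] deg[OF \<open>l \<noteq> - x\<close>] l unfolding sing_lits_def by simp
  qed
  then have sG: "sing_lits G = {- x}" using sing by blast
  then have dx: "ldeg G (- x) = 1" unfolding sing_lits_def by blast
  let ?X = "{K \<in> G. x \<in> K}"
  have fac: "clause_factor ?X" "?X \<noteq> G" using singular_clause_factor[OF G(1) dx] by simp_all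
  have sub: "?X \<subseteq> G" by blast
  have "ldeg F x \<le> ldeg G x" using deg x(1) by simp
  \<comment> \<open>The flip does not lower the degree of \<open>x\<close>, which was at least two
    in \<open>F\<close>.\<close>
  then have two: "2 \<le> card ?X" using ge2[OF x(5)] unfolding ldeg_def by linarith
  let ?R = "residue ?X" and ?Q = "contraction G ?X"
  define I where "I = \<Inter>?X"
  have R: "uhit ?R" using uhit_residue[OF G(1) sub fac(1)] .
  have mem: "E \<union> {x, - y} - I \<in> ?R" unfolding residue_def I_def using x(3) by blast
  \<comment> \<open>An empty clause cannot clash, so it would be the only clause of the
    residue.\<close>
  have "E \<union> {x, - y} - I \<noteq> {}"
  proof
    assume e: "E \<union> {x, - y} - I = {}"
    have "K = {}" if "K \<in> ?R" for K
      using uhit_clash[OF R mem that] unfolding e by blast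
    then have "?R \<subseteq> {{}}" by blast
    then have "card ?R \<le> card {{} :: int set}" by (intro card_mono) auto
    then show False using two card_residue[OF G(1) sub fac(1)] by simp
  qed
  then obtain l where l: "l \<in> E \<union> {x, - y} - I" by blast
  have "x \<in> I" unfolding I_def by blast
  then have "l \<in> E \<or> l = - y" using l by blast
  then have "\<bar>l\<bar> \<in> abs ` (E \<union> {y})" by (metis UnI1 UnI2 abs_minus_cancel imageI singletonI)
  moreover have "E \<union> {y} \<in> ?Q" unfolding contraction_def using x(2,4) by blast
  ultimately have "\<bar>l\<bar> \<in> vars ?Q" unfolding vars_def by blast
  moreover have "\<bar>l\<bar> \<in> vars ?R" using l mem unfolding vars_eq by blast
  ultimately have V: "vars ?R \<inter> vars ?Q \<noteq> {}" by blast
  have "finite (vars ?R)" using finite_vars[OF uhit_clause_set[OF R]] .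
  then have "0 < card (vars ?R \<inter> vars ?Q)" using V by (simp add: card_gt_0_iff)
  moreover have "int (num_vars G) + int (card (vars ?R \<inter> vars ?Q))
      \<le> 4 * deficiency G - 5 + int (card (sing_lits G))"
    by (rule num_vars_factor_le[OF G(1) sub fac(2,1) two]) (use bound dG V in auto)
  moreover have "num_vars G = num_vars F" using G(2) unfolding num_vars_def by simp
  \<comment> \<open>The gain from at least one shared variable offsets the single degree-one literal
    of \<open>G\<close>.\<close>
  ultimately show ?thesis using sG dG by simp
qed

text \<open>Flips keep variables and deficiency, so the bound can be transported back along the
  sequence. A first flip that creates a singular variable ends the induction early by
  \<open>flip_singular_num_vars_le\<close>.\<close>

lemma flips_to_reducible_num_vars_le:
  assumes "nfs_flip\<^sup>*\<^sup>* F G" "clause_reducible G" "uhit F" "sing_lits F = {}" "deficiency F = k"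
    and bound: "\<And>H. uhit H \<Longrightarrow> sing_lits H = {} \<Longrightarrow> vars H \<noteq> {} \<Longrightarrow> deficiency H < k \<Longrightarrow>
      int (num_vars H) \<le> 4 * deficiency H - 5"
  shows "int (num_vars F) \<le> 4 * k - 5"
  using assms(1-5)
proof (induction rule: converse_rtranclp_induct)
  case base
  then show ?case using reducible_num_vars_le[of G] bound by blast
next
  case (step F F1)
  have F1: "uhit F1" "vars F1 = vars F" "card F1 = card F"
    by (rule nfs_flip_facts[OF step.prems(2) step.hyps(1)], assumption)+
  show ?case
  proof (cases "sing_lits F1 = {}")
    case True
    then have "int (num_vars F1) \<le> 4 * k - 5"
      using step.IH step.prems F1 deficiency_cong[OF F1(2,3)] by simp
    then show ?thesis using F1(2) unfolding num_vars_def by simp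
  next
    case False
    then show ?thesis
      using flip_singular_num_vars_le[OF step.prems(2,3) step.hyps(1)] bound step.prems(4) by blast
  qed
qed

section \<open>The lower bound\<close>

text \<open>The ternary clauses take the all-false and the all-true assignment; the cyclic binary
  clauses split the other six into pairs. Deficiency two with three variables attains 4 * 2 -
  5.\<close>

definition three_cycle :: "int \<Rightarrow> int \<Rightarrow> int \<Rightarrow> int set set" where
  "three_cycle a b c = {{a, b, c}, {- a, - b, - c}, {a, - b}, {b, - c}, {c, - a}}"

lemma not_sing_lit: "C \<in> F \<Longrightarrow> D \<in> F \<Longrightarrow> C \<noteq> D \<Longrightarrow> l \<in> C \<Longrightarrow> l \<in> D \<Longrightarrow> l \<notin> sing_lits F"
  using ldeg_one_unique unfolding sing_lits_def by blast

context
  fixes a b c :: int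
  assumes pos: "0 < a" "a < b" "b < c"
begin

lemma three_cycle_distinct:
  "{a, b, c} \<noteq> {- a, - b, - c}" "{a, b, c} \<noteq> {a, - b}" "{a, b, c} \<noteq> {b, - c}" "{a, b, c} \<noteq> {c, - a}"
  "{- a, - b, - c} \<noteq> {a, - b}" "{- a, - b, - c} \<noteq> {b, - c}" "{- a, - b, - c} \<noteq> {c, - a}"
  "{a, - b} \<noteq> {b, - c}" "{a, - b} \<noteq> {c, - a}" "{b, - c} \<noteq> {c, - a}"
  using pos by (simp_all add: set_eq_subset)

lemma card_three_cycle: "card (three_cycle a b c) = 5"
  unfolding three_cycle_def using three_cycle_distinct by simp

lemma vars_three_cycle: "vars (three_cycle a b c) = {a, b, c}"
  unfolding vars_def three_cycle_def using pos by auto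

lemma uhit_three_cycle: "uhit (three_cycle a b c)"
  unfolding uhit_def
proof (intro conjI)
  show "clause_set (three_cycle a b c)"
    unfolding clause_set_def three_cycle_def clause_def using pos by auto
  show "unsatisfiable (three_cycle a b c)"
    unfolding unsatisfiable_def satisfiable_def
  proof
    assume "\<exists>P. clause P \<and> (\<forall>D\<in>three_cycle a b c. P \<inter> D \<noteq> {})"
    then obtain P where P: "clause P" "\<forall>D\<in>three_cycle a b c. P \<inter> D \<noteq> {}" by (elim exE conjE)
    have "a \<in> P \<or> b \<in> P \<or> c \<in> P" "- a \<in> P \<or> - b \<in> P \<or> - c \<in> P"
      "a \<in> P \<or> - b \<in> P" "b \<in> P \<or> - c \<in> P" "c \<in> P \<or> - a \<in> P"
      using P(2) unfolding three_cycle_def by auto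
    then show False using clauseD(3)[OF P(1), of a] clauseD(3)[OF P(1), of b] clauseD(3)[OF P(1), of c]
      by argo
  qed
  show "hitting (three_cycle a b c)"
    unfolding hitting_def three_cycle_def by auto
qed

lemma sing_lits_three_cycle: "sing_lits (three_cycle a b c) = {}"
proof (rule ccontr)
  assume "sing_lits (three_cycle a b c) \<noteq> {}"
  then obtain l where l: "l \<in> sing_lits (three_cycle a b c)" by blast
  then have "l \<in> \<Union>(three_cycle a b c)" using sing_lits_subset[OF uhit_three_cycle] by blast
  then have "l = a \<or> l = - a \<or> l = b \<or> l = - b \<or> l = c \<or> l = - c" unfolding three_cycle_def by blast
  moreover have "a \<notin> sing_lits (three_cycle a b c)"
    by (rule not_sing_lit[OF _ _ three_cycle_distinct(2)]) (simp_all add: three_cycle_def)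
  moreover have "b \<notin> sing_lits (three_cycle a b c)"
    by (rule not_sing_lit[OF _ _ three_cycle_distinct(3)]) (simp_all add: three_cycle_def)
  moreover have "c \<notin> sing_lits (three_cycle a b c)"
    by (rule not_sing_lit[OF _ _ three_cycle_distinct(4)]) (simp_all add: three_cycle_def)
  moreover have "- a \<notin> sing_lits (three_cycle a b c)"
    by (rule not_sing_lit[OF _ _ three_cycle_distinct(7)]) (simp_all add: three_cycle_def)
  moreover have "- b \<notin> sing_lits (three_cycle a b c)"
    by (rule not_sing_lit[OF _ _ three_cycle_distinct(5)]) (simp_all add: three_cycle_def)
  moreover have "- c \<notin> sing_lits (three_cycle a b c)"
    by (rule not_sing_lit[OF _ _ three_cycle_distinct(6)]) (simp_all add: three_cycle_def)
  ultimately show False using l by blast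
qed

end


text \<open>Each value of the new variable \<open>v\<close> leaves one of the two clause-sets. For
  disjoint variables the deficiency is the sum minus one, so gluing a three-cycle adds one to it and
  four variables.\<close>

definition glue :: "int \<Rightarrow> int set set \<Rightarrow> int set set \<Rightarrow> int set set" where
  "glue v F1 F2 = insert v ` F1 \<union> insert (- v) ` F2"

text \<open>The new literal \<open>u\<close> occurs in every clause of its half, of which there are
  at least two, and an old literal already has a second clause in \<open>H\<close>.\<close>

lemma not_sing_lit_insert:
  assumes "sing_lits H = {}" "2 \<le> card H" "u \<notin> \<Union>H" "insert u ` H \<subseteq> G"
    and C: "C \<in> H" "l \<in> insert u C"
  shows "l \<notin> sing_lits G"
proof -
  have "\<exists>D\<in>H. D \<noteq> C \<and> l \<in> insert u D"
  proof (cases "l = u")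
    case True
    have "\<not> H \<subseteq> {C}"
    proof
      assume "H \<subseteq> {C}"
      then have "card H \<le> card {C}" by (intro card_mono) auto
      then show False using assms(2) by simp
    qed
    then show ?thesis using True by blast
  next
    case False
    then have "l \<in> C" using C by simp
    have "{K \<in> H. l \<in> K} \<noteq> {C}"
    proof
      assume "{K \<in> H. l \<in> K} = {C}"
      then have "ldeg H l = 1" unfolding ldeg_def by simp
      then show False using assms(1) unfolding sing_lits_def by blast
    qed
    moreover have "C \<in> {K \<in> H. l \<in> K}" using C(1) \<open>l \<in> C\<close> by simp
    ultimately show ?thesis by blast
  qed
  then obtain D where D: "D \<in> H" "D \<noteq> C" "l \<in> insert u D" by blast
  have "u \<notin> C" "u \<notin> D" using assms(3) C(1) D(1) by blast+
  then have ne: "insert u C \<noteq> insert u D" using D(2) by (metis insert_ident)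
  show ?thesis by (rule not_sing_lit[OF _ _ ne C(2) D(3)]) (use assms(4) C(1) D(1) in blast)+
qed

context
  fixes v :: int and F1 F2 :: "int set set"
  assumes F1: "uhit F1" and F2: "uhit F2" and v: "0 < v" "v \<notin> vars F1" "v \<notin> vars F2"
begin

lemma glue_fresh: "v \<notin> \<Union>F1" "- v \<notin> \<Union>F1" "v \<notin> \<Union>F2" "- v \<notin> \<Union>F2"
  using v uhit_abs_in_vars[OF F1, of v] uhit_abs_in_vars[OF F1, of "- v"]
    uhit_abs_in_vars[OF F2, of v] uhit_abs_in_vars[OF F2, of "- v"] by simp_all

lemma uhit_glue: "uhit (glue v F1 F2)"
  unfolding uhit_iff
proof (intro conjI allI impI)
  have c1: "clause (insert v C)" if "C \<in> F1" for C
    using clause_insert[OF uhit_clause[OF F1 that], of v] v(1) glue_fresh(2) that by auto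
  have c2: "clause (insert (- v) C)" if "C \<in> F2" for C
    using clause_insert[OF uhit_clause[OF F2 that], of "- v"] v(1) glue_fresh(3) that by auto
  show "clause_set (glue v F1 F2)"
    using uhit_finite[OF F1] uhit_finite[OF F2] c1 c2 unfolding clause_set_def glue_def by blast
  fix S assume S: "total_assignment S"
  have vS: "v \<in> S \<longleftrightarrow> - v \<notin> S" using S v(1) unfolding total_assignment_def by (metis less_irrefl)
  show "\<exists>!D. D \<in> glue v F1 F2 \<and> D \<inter> S = {}"
  proof (cases "v \<in> S")
    case True
    obtain D where D: "D \<in> F2" "D \<inter> S = {}" using uhit_ex[OF F2 S] by blast
    show ?thesis
    proof (rule ex1I)
      show "insert (- v) D \<in> glue v F1 F2 \<and> insert (- v) D \<inter> S = {}"
        using D True vS unfolding glue_def by simp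
      fix K assume K: "K \<in> glue v F1 F2 \<and> K \<inter> S = {}"
      then obtain C where C: "C \<in> F2" "K = insert (- v) C" using True unfolding glue_def by blast
      then have "C = D" using uhit_unique[OF F2 S C(1) D(1) _ D(2)] K by blast
      then show "K = insert (- v) D" using C by simp
    qed
  next
    case False
    obtain D where D: "D \<in> F1" "D \<inter> S = {}" using uhit_ex[OF F1 S] by blast
    show ?thesis
    proof (rule ex1I)
      show "insert v D \<in> glue v F1 F2 \<and> insert v D \<inter> S = {}"
        using D False unfolding glue_def by simp
      fix K assume K: "K \<in> glue v F1 F2 \<and> K \<inter> S = {}"
      then obtain C where C: "C \<in> F1" "K = insert v C" using False vS unfolding glue_def by blast
      then have "C = D" using uhit_unique[OF F1 S C(1) D(1) _ D(2)] K by blast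
      then show "K = insert v D" using C by simp
    qed
  qed
qed

lemma card_glue: "card (glue v F1 F2) = card F1 + card F2"
proof -
  have inj: "inj_on (insert u) H" if "u \<notin> \<Union>H" for u :: int and H
    using that by (intro inj_onI) (metis UnionI insert_ident)
  have "insert v ` F1 \<inter> insert (- v) ` F2 = {}"
  proof -
    have "v \<notin> insert (- v) D" if "D \<in> F2" for D using that glue_fresh(3) v(1) by auto
    then show ?thesis by blast
  qed
  then show ?thesis
    unfolding glue_def using uhit_finite[OF F1] uhit_finite[OF F2] glue_fresh
    by (simp add: card_Un_disjoint card_image inj)
qed

lemma vars_glue: "vars (glue v F1 F2) = insert v (vars F1 \<union> vars F2)"
proof -
  have "\<Union>(glue v F1 F2) = {v, - v} \<union> \<Union>F1 \<union> \<Union>F2"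
    using uhit_nonempty[OF F1] uhit_nonempty[OF F2] unfolding glue_def by blast
  then show ?thesis using v(1) unfolding vars_eq by (simp add: image_Un)
qed

lemma sing_lits_glue:
  assumes "sing_lits F1 = {}" "sing_lits F2 = {}" "2 \<le> card F1" "2 \<le> card F2"
  shows "sing_lits (glue v F1 F2) = {}"
proof (rule ccontr)
  assume "sing_lits (glue v F1 F2) \<noteq> {}"
  then obtain l where l: "l \<in> sing_lits (glue v F1 F2)" by blast
  then obtain K where K: "K \<in> glue v F1 F2" "l \<in> K" using sing_lits_subset[OF uhit_glue] by blast
  have s1: "insert v ` F1 \<subseteq> glue v F1 F2" and s2: "insert (- v) ` F2 \<subseteq> glue v F1 F2"
    unfolding glue_def by blast+
  consider C where "C \<in> F1" "K = insert v C" | C where "C \<in> F2" "K = insert (- v) C"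
    using K(1) unfolding glue_def by blast
  then show False
  proof cases
    case 1
    then show False using not_sing_lit_insert[OF assms(1,3) glue_fresh(1) s1 1(1)] K(2) l by blast
  next
    case 2
    then show False using not_sing_lit_insert[OF assms(2,4) glue_fresh(4) s2 2(1)] K(2) l by blast
  qed
qed

end

text \<open>Here \<open>n\<close> counts the glued copies beyond the first: the deficiency is n + 2,
  and 4 n + 3 = 4 (n + 2) - 5.\<close>

lemma ex_nonsingular_uhit:
  "\<exists>F. uhit F \<and> sing_lits F = {} \<and> card F = 5 * n + 5 \<and> num_vars F = 4 * n + 3"
proof (induction n)
  case 0
  have "num_vars (three_cycle 1 2 3) = 3" unfolding num_vars_def by (simp add: vars_three_cycle)
  then show ?case
    using uhit_three_cycle[of 1 2 3] sing_lits_three_cycle[of 1 2 3] card_three_cycle[of 1 2 3]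
    by (intro exI[of _ "three_cycle 1 2 3"]) simp
next
  case (Suc n)
  then obtain F where F: "uhit F" "sing_lits F = {}" "card F = 5 * n + 5" "num_vars F = 4 * n + 3"
    by blast
  have fin: "finite (vars F)" using finite_vars[OF uhit_clause_set[OF F(1)]] .
  \<comment> \<open>All variables from \<open>v\<close> on are new; inserting 0 makes
    \<open>v\<close> positive.\<close>
  define v where "v = Max (insert 0 (vars F)) + 1"
  have lt: "x < v" if "x \<in> insert 0 (vars F)" for x
    using Max_ge[OF _ that] fin unfolding v_def by simp
  let ?T = "three_cycle (v + 1) (v + 2) (v + 3)"
  have pos: "0 < v + 1" "v + 1 < v + 2" "v + 2 < v + 3" using lt[of 0] by simp_all
  have T: "uhit ?T" "sing_lits ?T = {}" "card ?T = 5" "vars ?T = {v + 1, v + 2, v + 3}"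
    using uhit_three_cycle[OF pos] sing_lits_three_cycle[OF pos] card_three_cycle[OF pos]
      vars_three_cycle[OF pos] .
  have v: "0 < v" "v \<notin> vars F" "v \<notin> vars ?T" using lt[of 0] lt[of v] T(4) by auto
  have "vars F \<inter> vars ?T = {}" using lt T(4) by force
  then have "card (vars F \<union> vars ?T) = card (vars F) + card (vars ?T)"
    using fin T(4) by (intro card_Un_disjoint) simp_all
  then have "num_vars (glue v F ?T) = 4 * Suc n + 3"
    using vars_glue[OF F(1) T(1) v] v(2,3) fin F(4) T(4) unfolding num_vars_def by simp
  moreover have "card (glue v F ?T) = 5 * Suc n + 5"
    using card_glue[OF F(1) T(1) v] F(3) T(3) by simp
  ultimately show ?case
    using uhit_glue[OF F(1) T(1) v] sing_lits_glue[OF F(1) T(1) v F(2) T(2)] F(3) T(3)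
    by (intro exI[of _ "glue v F ?T"]) simp
qed

section \<open>The value of \<open>max_vars\<close> and the equivalence\<close>

lemma max_vars_ge:
  assumes "2 \<le> k"
  shows "enat (nat (4 * k - 5)) \<le> max_vars k"
proof -
  obtain F where F: "uhit F" "sing_lits F = {}" "card F = 5 * nat (k - 2) + 5"
      "num_vars F = 4 * nat (k - 2) + 3"
    using ex_nonsingular_uhit by blast
  have "deficiency F = k" using F(3,4) assms unfolding deficiency_def num_clauses_def by simp
  moreover have "nonsingular F" using nonsingular_iff[OF F(1)] F(2) by blast
  moreover have "num_vars F = nat (4 * k - 5)" using F(4) assms by simp
  ultimately show ?thesis
    unfolding max_vars_def using F(1) by (intro SUP_upper2[of F]) simp_all
qed

lemma num_vars_le_max_vars:
  assumes "uhit F" "sing_lits F = {}" "max_vars (deficiency F) = enat N"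
  shows "num_vars F \<le> N"
proof -
  have "nonsingular F" using nonsingular_iff[OF assms(1)] assms(2) by blast
  then have "enat (num_vars F) \<le> max_vars (deficiency F)"
    unfolding max_vars_def using assms(1) by (intro SUP_upper) simp
  then show ?thesis using assms(3) by simp
qed

theorem theorem2:
  fixes k :: int
  assumes "k \<ge> 3"
    and "\<And>k'. 3 \<le> k' \<Longrightarrow> k' < k \<Longrightarrow> max_vars k' = enat (nat (4 * k' - 5))"
  shows "max_vars k = enat (nat (4 * k - 5)) \<longleftrightarrow>
    (\<forall>F. uhit F \<and> clause_irreducible F \<and> nfs_irreducible F \<and> deficiency F = k \<longrightarrow>
       int (num_vars F) \<le> 4 * k - 5)"
proof
  assume max: "max_vars k = enat (nat (4 * k - 5))"
  show "\<forall>F. uhit F \<and> clause_irreducible F \<and> nfs_irreducible F \<and> deficiency F = k \<longrightarrow>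
       int (num_vars F) \<le> 4 * k - 5"
  proof (intro allI impI, elim conjE)
    fix F assume F: "uhit F" "clause_irreducible F" "deficiency F = k"
    \<comment> \<open>Irreducibility alone places \<open>F\<close> among the clause-sets over which
      \<open>max_vars k\<close> is taken.\<close>
    then have "sing_lits F = {}" using irreducible_nonsingular assms(1) by simp
    then have "num_vars F \<le> nat (4 * k - 5)" using num_vars_le_max_vars F max by simp
    then show "int (num_vars F) \<le> 4 * k - 5" using assms(1) by linarith
  qed
next
  assume irr: "\<forall>F. uhit F \<and> clause_irreducible F \<and> nfs_irreducible F \<and> deficiency F = k \<longrightarrow>
       int (num_vars F) \<le> 4 * k - 5"
  \<comment> \<open>The assumption starts at deficiency three; deficiency two has its own lemma, and
    deficiency one is impossible here.\<close>
  have bound: "int (num_vars H) \<le> 4 * deficiency H - 5"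
    if H: "uhit H" "sing_lits H = {}" "vars H \<noteq> {}" "deficiency H < k" for H
  proof (cases "deficiency H = 2")
    case True
    then show ?thesis using num_vars_deficiency_two[OF H(1,2)] by simp
  next
    case False
    then have "3 \<le> deficiency H" using nonsingular_deficiency[OF H(1-3)] by simp
    then have "num_vars H \<le> nat (4 * deficiency H - 5)"
      using num_vars_le_max_vars[OF H(1,2)] assms(2) H(4) by blast
    then show ?thesis using \<open>3 \<le> deficiency H\<close> by linarith
  qed
  have "enat (num_vars F) \<le> enat (nat (4 * k - 5))"
    if F: "uhit F" "nonsingular F" "deficiency F = k" for F
  proof -
    have ns: "sing_lits F = {}" using nonsingular_iff F by blast
    have "int (num_vars F) \<le> 4 * k - 5"
    proof (cases "\<exists>G. nfs_flip\<^sup>*\<^sup>* F G \<and> clause_reducible G")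
      case True
      then show ?thesis using flips_to_reducible_num_vars_le[OF _ _ F(1) ns F(3) bound] by blast
    next
      case False
      \<comment> \<open>The empty sequence of flips counts, so \<open>F\<close> itself is not
        reducible.\<close>
      then have "clause_irreducible F" unfolding clause_reducible_def by blast
      then show ?thesis using irr F False unfolding nfs_irreducible_def by blast
    qed
    then show ?thesis by simp
  qed
  then have "max_vars k \<le> enat (nat (4 * k - 5))" unfolding max_vars_def by (intro SUP_least) simp
  then show "max_vars k = enat (nat (4 * k - 5))" using max_vars_ge[of k] assms(1) by (intro antisym) simp_all
qed

end
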